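(* Let $k\geq 3$ and $t\geq 2$ be integers. Let $\boldsymbol{F}$ be a $(k-1)$-dimensional simplicial complex such that $\boldsymbol{F}$ contains a copy of $M^k_t$ and $\boldsymbol{F}$ is contained in a copy of $\boldsymbol{\mathcal D}(C^k_{2t})$. Then $\boldsymbol{F}$ is asymptotically trivial, and \[\mathrm{ex}(n,\boldsymbol{F})=\sum_{r=0}^{t-1}\binom{t-1}{r}\binom{n}{k-1}+o(n^{k-1}).\]
   Context: An (abstract) simplicial complex $\boldsymbol{F}=(V,E)$ is a hypergraph with $E\subseteq 2^V$ containing all singletons and closed under taking subsets (the empty set is also an edge); its dimension is its maximum edge size minus $1$. $\boldsymbol{F}^r$ is the $r$-uniform hypergraph of all $r$-element edges of $\boldsymbol{F}$; $\boldsymbol F$ containing a copy of a $k$-uniform hypergraph means $\boldsymbol F^k$ contains a copy of it. A simplicial complex is $\boldsymbol{F}$-free if it contains no isomorphic copy of $\boldsymbol{F}$, and $\mathrm{ex}(n,\boldsymbol{F})$ is the maximum number of edges of an $\boldsymbol{F}$-free simplicial complex on $n$ vertices. For a hypergraph $H$, $\boldsymbol{\mathcal D}(H)$ is the simplicial complex on $V(H)$ whose edges are all singletons and all subsets of edges of $H$. $M^k_t$ is the $k$-uniform matching with $t$ pairwise disjoint edges; $C^k_{2t}$ is the $k$-uniform linear cycle with $2t$ edges (edges cyclically ordered, consecutive edges share exactly one vertex, non-consecutive edges disjoint, every vertex in at most two edges). Given a $k$-uniform hypergraph $G$, a set $T\subseteq V(G)$ is a clique in $G$ if $T$ is a singleton,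 or $T$ is a subset of some edge of $G$, or every $k$-subset of $T$ is an edge of $G$; $\mathrm{ex}_k^{c\ell+}(n,H)$ is the maximum number of cliques of order at least $k$ in an $n$-vertex $H$-free $k$-uniform hypergraph. A $(k-1)$-dimensional simplicial complex $\boldsymbol{F}$ is asymptotically trivial if $\mathrm{ex}(n,\boldsymbol{F})=\mathrm{ex}_k^{c\ell+}(n,\boldsymbol{F}^k)+\sum_{r=0}^{k-1}\binom{n}{r}+o(n^{k-1})$ as $n\to\infty$. *)

theory Defs
  imports Complex_Main "HOL-Library.Landau_Symbols"
begin

datatype 'a hypergraph = Hypergraph (verts: "'a set") (edges: "'a set set")

definition hypergraph :: "'a hypergraph \<Rightarrow> bool" where
  "hypergraph H \<longleftrightarrow> finite (verts H) \<and> edges H \<subseteq> Pow (verts H)"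

definition uniform :: "nat \<Rightarrow> 'a hypergraph \<Rightarrow> bool" where
  "uniform k H \<longleftrightarrow> hypergraph H \<and> (\<forall>e\<in>edges H. card e = k)"

definition simplicial_complex :: "'a hypergraph \<Rightarrow> bool" where
  "simplicial_complex F \<longleftrightarrow>
     hypergraph F \<and>
     {} \<in> edges F \<and>
     (\<forall>v\<in>verts F. {v} \<in> edges F) \<and>
     (\<forall>e\<in>edges F. \<forall>e'. e' \<subseteq> e \<longrightarrow> e' \<in> edges F)"

text \<open>Integer-valued, since the complex on no vertices has dimension \<open>-1\<close>.\<close>

definition complex_dim :: "'a hypergraph \<Rightarrow> int" where
  "complex_dim F = int (Max (card ` edges F)) - 1"

definition layer :: "nat \<Rightarrow> 'a hypergraph \<Rightarrow> 'a hypergraph" where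
  "layer r F = Hypergraph (verts F) {e \<in> edges F. card e = r}"

text \<open>Copies are not required to be induced. The same notion serves hypergraphs and
  simplicial complexes.\<close>

definition contains_copy :: "'a hypergraph \<Rightarrow> 'b hypergraph \<Rightarrow> bool" where
  "contains_copy G H \<longleftrightarrow>
     (\<exists>f. inj_on f (verts H) \<and> f ` verts H \<subseteq> verts G \<and> (\<forall>e\<in>edges H. f ` e \<in> edges G))"

definition downset_complex :: "'a hypergraph \<Rightarrow> 'a hypergraph" where
  "downset_complex H =
     Hypergraph (verts H)
       (insert {} ({{v} |v. v \<in> verts H} \<union> {s. \<exists>e\<in>edges H. s \<subseteq> e}))"

text \<open>The next two predicates determine their hypergraph up to isomorphism; the condition
  \<open>verts H = \<Union> (edges H)\<close> excludes isolated vertices.\<close>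

definition is_matching :: "nat \<Rightarrow> nat \<Rightarrow> 'a hypergraph \<Rightarrow> bool" where
  "is_matching k t M \<longleftrightarrow>
     uniform k M \<and> verts M = \<Union> (edges M) \<and> card (edges M) = t \<and>
     (\<forall>e\<in>edges M. \<forall>e'\<in>edges M. e \<noteq> e' \<longrightarrow> e \<inter> e' = {})"

definition is_linear_cycle :: "nat \<Rightarrow> nat \<Rightarrow> 'a hypergraph \<Rightarrow> bool" where
  "is_linear_cycle k m C \<longleftrightarrow>
     uniform k C \<and> verts C = \<Union> (edges C) \<and>
     (\<exists>e. bij_betw e {..<m} (edges C) \<and>
        (\<forall>i<m. card (e i \<inter> e (Suc i mod m)) = 1) \<and>
        (\<forall>i<m. \<forall>j<m. i \<noteq> j \<and> j \<noteq> Suc i mod m \<and> i \<noteq> Suc j mod m \<longrightarrow> e i \<inter> e j = {})) \<and>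
     (\<forall>v\<in>verts C. card {d \<in> edges C. v \<in> d} \<le> 2)"

text \<open>The empty set counts as an edge of a simplicial complex. Every finite complex has an
  isomorphic copy with vertices in \<^typ>\<open>nat\<close>. The set of cardinalities is bounded
  by \<open>2 ^ n\<close>, and it is nonempty as soon as \<open>F\<close> has dimension at least 1.\<close>

definition ex_complex :: "nat \<Rightarrow> 'a hypergraph \<Rightarrow> nat" where
  "ex_complex n F =
     Max {card (edges G) |G :: nat hypergraph.
            simplicial_complex G \<and> card (verts G) = n \<and> \<not> contains_copy G F}"

definition is_clique :: "nat \<Rightarrow> 'a hypergraph \<Rightarrow> 'a set \<Rightarrow> bool" where
  "is_clique k G T \<longleftrightarrow>
     T \<subseteq> verts G \<and>
     ((\<exists>v. T = {v}) \<or> (\<exists>e\<in>edges G. T \<subseteq> e) \<or> (\<forall>s. s \<subseteq> T \<and> card s = k \<longrightarrow> s \<in> edges G))"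

definition ex_clique :: "nat \<Rightarrow> nat \<Rightarrow> 'a hypergraph \<Rightarrow> nat" where
  "ex_clique k n H =
     Max {card {T. is_clique k G T \<and> k \<le> card T} |G :: nat hypergraph.
            uniform k G \<and> card (verts G) = n \<and> \<not> contains_copy G H}"

definition asymptotically_trivial :: "nat \<Rightarrow> 'a hypergraph \<Rightarrow> bool" where
  "asymptotically_trivial k F \<longleftrightarrow>
     simplicial_complex F \<and> complex_dim F = int k - 1 \<and>
     (\<lambda>n. real (ex_complex n F) -
           (real (ex_clique k n (layer k F)) + (\<Sum>r=0..k-1. real (n choose r))))
       \<in> o(\<lambda>n. real n ^ (k - 1))"

end

(* Lower bound: take all sets with at most k - 1 vertices outside a fixed set S of t - 1 vertices. Of t
   disjoint k-edges one would avoid S, so this complex and the corresponding k-graph are F-free.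

   Upper bound: let G contain no linear 2t-cycle and write w = k - 1. Repeatedly delete a w-face with fewer
   than t extensions together with everything above it; this costs at most 2^(t-1) edges per w-face, and in the
   remaining complex every w-face has at least t extensions. The same deletion with a large constant D instead
   of t - 1 removes everything (a complex with only D-rich w-faces contains the cycle greedily), so the
   remaining complex has at most 2^D edges of size >= w per w-face. It therefore suffices that positive density of
   w-faces, each with t extensions ("colours"), forces the cycle.

   For this, view the w-faces as triples (x, y, Z) with |Z| = k - 3 and fix a set C of colours common to all
   faces such that every other colour is rare. Counting copies of the complete tripartite K(3t,3t,3t) yields
   one in which faces without common part have disjoint colour lists outside C. With |C| = t the common colours
   close the cycle in pairs; with |C| = t - 1 one pair must meet in a vertex and use two distinct rare colours; with
   |C| <= t - 2 every list has two rare colours and a cyclic choice of distinct representatives exists. *)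
theory Submission
  imports Defs "HOL-Library.FuncSet"
begin

section \<open>Copies of linear cycles\<close>

text \<open>The threshold \<open>t\<close> and the length \<open>2 * t\<close> belong together: a
  vertex of a linear cycle lies in at most two of its edges, so t common colours serve exactly 2t
  edges, while t - 1 of them, as in the extremal construction, fall one pair short. The delicate
  faces are those with barely t colours, where a single rare colour has to be controlled; this is
  why conflicts between faces are counted and not densities alone. Consecutive edges share at most
  their x-vertex, their y-vertex or their colour, so the other k - 3 vertices of a face can be kept
  together as one set \<open>Z\<close>, and a tripartite count serves all k. For k = 3 the third
  part consists of the empty set alone. What is counted are homomorphisms: coinciding vertices are
  treated as conflicts and disappear with them. The second deletion is there because edges of all
  sizes count: few (k-1)-faces do not by themselves bound the number of edges above them.\<close>

definition linear_cycle_family :: "nat \<Rightarrow> nat \<Rightarrow> (nat \<Rightarrow> 'a set) \<Rightarrow> bool" where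
  "linear_cycle_family k m g \<longleftrightarrow>
     (\<forall>i<m. finite (g i) \<and> card (g i) = k) \<and>
     (\<forall>i<m. \<forall>j<m. i \<noteq> j \<longrightarrow>
        card (g i \<inter> g j) = (if j = Suc i mod m \<or> i = Suc j mod m then 1 else 0))"

section \<open>Venn regions as an isomorphism invariant of set families\<close>

definition venn_region :: "'i set \<Rightarrow> ('i \<Rightarrow> 'a set) \<Rightarrow> 'i set \<Rightarrow> 'a set" where
  "venn_region I g S = {v. {i \<in> I. v \<in> g i} = S}"

lemma finite_venn_region:
  assumes "\<And>i. i \<in> I \<Longrightarrow> finite (g i)" "S \<noteq> {}"
  shows "finite (venn_region I g S)"
proof -
  obtain i where i: "i \<in> S" using assms(2) by blast
  show ?thesis
  proof (cases "i \<in> I")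
    case True
    have "venn_region I g S \<subseteq> g i" using i by (auto simp: venn_region_def)
    then show ?thesis using assms(1)[OF True] finite_subset by blast
  next
    case False
    then have "venn_region I g S = {}" using i by (auto simp: venn_region_def)
    then show ?thesis by simp
  qed
qed

text \<open>Bijections between corresponding regions are glued along the type \<open>ty v\<close>,
  the set of indices whose member contains v. The region of the empty index set is left out, being
  the possibly infinite outside of the family.\<close>

lemma venn_isomorphism:
  fixes e :: "'i \<Rightarrow> 'a set" and g :: "'i \<Rightarrow> 'b set"
  assumes fe: "\<And>i. i \<in> I \<Longrightarrow> finite (e i)" and fg: "\<And>i. i \<in> I \<Longrightarrow> finite (g i)"
    and eq: "\<And>S. S \<subseteq> I \<Longrightarrow> S \<noteq> {} \<Longrightarrow> card (venn_region I e S) = card (venn_region I g S)"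
  obtains f where "inj_on f (\<Union>i\<in>I. e i)" "\<And>i. i \<in> I \<Longrightarrow> f ` e i = g i"
proof -
  have "\<exists>h. bij_betw h (venn_region I e S) (venn_region I g S)" if "S \<subseteq> I" "S \<noteq> {}" for S
    using finite_same_card_bij[OF finite_venn_region[OF fe] finite_venn_region[OF fg] eq] that by blast
  then obtain h where h: "\<And>S. S \<subseteq> I \<Longrightarrow> S \<noteq> {} \<Longrightarrow> bij_betw (h S) (venn_region I e S) (venn_region I g S)"
    by metis
  define ty where "ty = (\<lambda>v. {i \<in> I. v \<in> e i})"
  define f where "f = (\<lambda>v. h (ty v) v)"
  have ty: "ty v \<subseteq> I" for v by (auto simp: ty_def)
  have f_ty: "{i \<in> I. f v \<in> g i} = ty v" if "v \<in> (\<Union>i\<in>I. e i)" for v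
  proof -
    have "ty v \<noteq> {}" using that by (auto simp: ty_def)
    moreover have "v \<in> venn_region I e (ty v)" by (auto simp: ty_def venn_region_def)
    ultimately have "f v \<in> venn_region I g (ty v)"
      using h[OF ty] unfolding f_def bij_betw_def by blast
    then show ?thesis by (auto simp: venn_region_def)
  qed
  have "inj_on f (\<Union>i\<in>I. e i)"
  proof (rule inj_onI)
    fix v v' assume v: "v \<in> (\<Union>i\<in>I. e i)" and v': "v' \<in> (\<Union>i\<in>I. e i)" and eqf: "f v = f v'"
    have same: "ty v = ty v'" using f_ty[OF v] f_ty[OF v'] eqf by simp
    have "ty v \<noteq> {}" using v by (auto simp: ty_def)
    then have "inj_on (h (ty v)) (venn_region I e (ty v))" using h[OF ty] by (auto simp: bij_betw_def)
    moreover have "v \<in> venn_region I e (ty v)" "v' \<in> venn_region I e (ty v)"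
      using same by (auto simp: ty_def venn_region_def)
    ultimately show "v = v'" using eqf same by (auto simp: f_def inj_on_def)
  qed
  moreover have "f ` e i = g i" if i: "i \<in> I" for i
  proof
    show "f ` e i \<subseteq> g i" using f_ty i by (auto simp: ty_def)
    show "g i \<subseteq> f ` e i"
    proof
      fix w assume w: "w \<in> g i"
      define S where "S = {i \<in> I. w \<in> g i}"
      have S: "S \<subseteq> I" "S \<noteq> {}" "w \<in> venn_region I g S" "i \<in> S"
        using w i by (auto simp: S_def venn_region_def)
      have "w \<in> h S ` venn_region I e S" using h[OF S(1,2)] S(3) by (simp add: bij_betw_def)
      then obtain v where v: "v \<in> venn_region I e S" "h S v = w" by auto
      then have "ty v = S" by (auto simp: ty_def venn_region_def)
      then show "w \<in> f ` e i" using v S(4) by (auto simp: f_def ty_def)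
    qed
  qed
  ultimately show ?thesis using that by blast
qed

lemma card_eq_sum_venn_region:
  assumes "finite I" "\<And>i. i \<in> I \<Longrightarrow> finite (g i)" "i \<in> I"
  shows "card (g i) = (\<Sum>S\<in>{S \<in> Pow I. i \<in> S}. card (venn_region I g S))"
proof -
  let ?P = "{S \<in> Pow I. i \<in> S}"
  have "g i = (\<Union>S\<in>?P. venn_region I g S)"
  proof (intro set_eqI iffI)
    fix v assume "v \<in> g i"
    then have "{i \<in> I. v \<in> g i} \<in> ?P" "v \<in> venn_region I g {i \<in> I. v \<in> g i}"
      using assms(3) by (simp_all add: venn_region_def)
    then show "v \<in> (\<Union>S\<in>?P. venn_region I g S)" by (rule UN_I)
  next
    fix v assume "v \<in> (\<Union>S\<in>?P. venn_region I g S)"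
    then obtain S where "i \<in> S" "{i \<in> I. v \<in> g i} = S" by (auto simp: venn_region_def)
    then show "v \<in> g i" by blast
  qed
  moreover have "card (\<Union>S\<in>?P. venn_region I g S) = (\<Sum>S\<in>?P. card (venn_region I g S))"
  proof (rule card_UN_disjoint)
    show "finite ?P" using assms(1) by simp
    show "\<forall>S\<in>?P. finite (venn_region I g S)"
      using finite_venn_region[of I g] assms(2) by auto
    show "\<forall>S\<in>?P. \<forall>T\<in>?P. S \<noteq> T \<longrightarrow> venn_region I g S \<inter> venn_region I g T = {}"
      by (auto simp: venn_region_def)
  qed
  ultimately show ?thesis by simp
qed

section \<open>Linear cycles of length at least four are determined up to isomorphism\<close>

lemma eq_Suc_mod_iff:
  fixes m :: nat assumes "i < m"
  shows "j = Suc i mod m \<longleftrightarrow> (Suc i < m \<and> j = Suc i) \<or> (Suc i = m \<and> j = 0)"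
  using assms by (cases "Suc i = m") auto

text \<open>For m = 3 all indices are mutually adjacent, and three edges through one common vertex
  would have the right pairwise intersections. The bound 4 is met because the cycles have 2t edges
  with t >= 2.\<close>

lemma no_cyclic_triangle:
  fixes m :: nat
  assumes "m \<ge> 4" "i < m" "j < m" "l < m" "i \<noteq> j" "i \<noteq> l" "j \<noteq> l"
    and "j = Suc i mod m \<or> i = Suc j mod m" "l = Suc j mod m \<or> j = Suc l mod m"
    and "l = Suc i mod m \<or> i = Suc l mod m"
  shows False
  using assms(1,5-10) unfolding eq_Suc_mod_iff[OF assms(2)] eq_Suc_mod_iff[OF assms(3)] eq_Suc_mod_iff[OF assms(4)]
  by linarith

text \<open>A common vertex would make the three indices pairwise adjacent. This recovers from
  pairwise intersections alone that a vertex lies in at most two edges.\<close>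

lemma linear_cycle_family_triple:
  assumes g: "linear_cycle_family k m g" and "m \<ge> 4"
    and "i < m" "j < m" "l < m" "i \<noteq> j" "i \<noteq> l" "j \<noteq> l"
  shows "g i \<inter> g j \<inter> g l = {}"
proof (rule ccontr)
  assume ne: "g i \<inter> g j \<inter> g l \<noteq> {}"
  have fin: "finite (g x)" if "x < m" for x using g that by (auto simp: linear_cycle_family_def)
  have adj: "y = Suc x mod m \<or> x = Suc y mod m" if "x < m" "y < m" "x \<noteq> y" "g x \<inter> g y \<noteq> {}" for x y
  proof (rule ccontr)
    assume "\<not> (y = Suc x mod m \<or> x = Suc y mod m)"
    then have "card (g x \<inter> g y) = 0" using g that by (auto simp: linear_cycle_family_def)
    then show False using fin[OF that(1)] that(4) by simp
  qed
  show False using no_cyclic_triangle[OF assms(2-8)] adj[of i j] adj[of j l] adj[of i l] assms(3-8) ne by blast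
qed

lemma venn_region_pair:
  assumes g: "linear_cycle_family k m g" and m: "m \<ge> 4" and "i < m" "j < m" "i \<noteq> j"
  shows "venn_region {..<m} g {i, j} = g i \<inter> g j"
proof
  show "venn_region {..<m} g {i, j} \<subseteq> g i \<inter> g j" by (auto simp: venn_region_def)
  show "g i \<inter> g j \<subseteq> venn_region {..<m} g {i, j}"
    using linear_cycle_family_triple[OF g m assms(3,4) _ assms(5)] assms(3,4)
    by (auto simp: venn_region_def)
qed

lemma venn_region_triple:
  assumes g: "linear_cycle_family k m g" and m: "m \<ge> 4" and "S \<subseteq> {..<m}"
    and "i \<in> S" "j \<in> S" "l \<in> S" "i \<noteq> j" "i \<noteq> l" "j \<noteq> l"
  shows "venn_region {..<m} g S = {}"
  using linear_cycle_family_triple[OF g m, of i j l] assms(3-9) by (auto simp: venn_region_def)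

lemma card_eq_venn_region_single:
  assumes "linear_cycle_family k m g" "i < m"
  shows "card (venn_region {..<m} g {i}) +
    (\<Sum>S\<in>{S \<in> Pow {..<m}. i \<in> S} - {{i}}. card (venn_region {..<m} g S)) = k"
proof -
  have "finite {S \<in> Pow {..<m}. i \<in> S}" "{i} \<in> {S \<in> Pow {..<m}. i \<in> S}" using assms(2) by auto
  from sum.remove[OF this, of "\<lambda>S. card (venn_region {..<m} g S)"]
  show ?thesis
    using card_eq_sum_venn_region[of "{..<m}" g i] assms by (simp add: linear_cycle_family_def)
qed

text \<open>Regions of three or more indices are empty, those of two indices are the pairwise
  intersections, and the region of a single index is what then remains of the k vertices. So k and m
  fix all sizes.\<close>

lemma card_venn_region_linear_cycle_family:
  assumes e: "linear_cycle_family k m e" and g: "linear_cycle_family k m g" and m: "m \<ge> 4"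
    and S: "S \<subseteq> {..<m}" "S \<noteq> {}"
  shows "card (venn_region {..<m} e S) = card (venn_region {..<m} g S)"
proof -
  have big: "card (venn_region {..<m} e S) = card (venn_region {..<m} g S)"
    if S: "S \<subseteq> {..<m}" and ij: "i \<in> S" "j \<in> S" "i \<noteq> j" for S i j
  proof (cases "S = {i, j}")
    case True
    have ijm: "i < m" "j < m" using S ij by auto
    have "card (e i \<inter> e j) = card (g i \<inter> g j)"
      using e g ijm ij(3) unfolding linear_cycle_family_def by metis
    then show ?thesis
      using venn_region_pair[OF e m ijm ij(3)] venn_region_pair[OF g m ijm ij(3)] True by metis
  next
    case False
    then obtain l where "l \<in> S" "i \<noteq> l" "j \<noteq> l" using ij by blast
    then have "venn_region {..<m} e S = {}" "venn_region {..<m} g S = {}"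
      using venn_region_triple[OF e m S ij(1,2)] venn_region_triple[OF g m S ij(1,2)] ij(3) by blast+
    then show ?thesis by simp
  qed
  obtain i where i: "i \<in> S" using S by blast
  show ?thesis
  proof (cases "S = {i}")
    case False
    then obtain j where "j \<in> S" "i \<noteq> j" using i by blast
    then show ?thesis using big[OF S(1) i] by blast
  next
    case True
    have im: "i < m" using i S by auto
    have "(\<Sum>S\<in>{S \<in> Pow {..<m}. i \<in> S} - {{i}}. card (venn_region {..<m} e S))
        = (\<Sum>S\<in>{S \<in> Pow {..<m}. i \<in> S} - {{i}}. card (venn_region {..<m} g S))"
    proof (rule sum.cong[OF refl])
      fix S assume S: "S \<in> {S \<in> Pow {..<m}. i \<in> S} - {{i}}"
      then obtain j where "j \<in> S" "i \<noteq> j" by blast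
      then show "card (venn_region {..<m} e S) = card (venn_region {..<m} g S)"
        using big[of S i j] S by blast
    qed
    then show ?thesis
      using card_eq_venn_region_single[OF e im] card_eq_venn_region_single[OF g im] True by simp
  qed
qed

lemma is_linear_cycle_family:
  assumes "is_linear_cycle k m C"
  obtains e where "bij_betw e {..<m} (edges C)" "linear_cycle_family k m e"
proof -
  obtain e where e: "bij_betw e {..<m} (edges C)"
    and adj: "\<forall>i<m. card (e i \<inter> e (Suc i mod m)) = 1"
    and nadj: "\<forall>i<m. \<forall>j<m. i \<noteq> j \<and> j \<noteq> Suc i mod m \<and> i \<noteq> Suc j mod m \<longrightarrow> e i \<inter> e j = {}"
    using assms by (auto simp: is_linear_cycle_def)
  have u: "uniform k C" using assms by (simp add: is_linear_cycle_def)
  have ei: "e i \<in> edges C" if "i < m" for i using e that by (auto simp: bij_betw_def)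
  have "finite (e i) \<and> card (e i) = k" if "i < m" for i
    using ei[OF that] u by (auto simp: uniform_def hypergraph_def intro: finite_subset)
  moreover have "card (e i \<inter> e j) = (if j = Suc i mod m \<or> i = Suc j mod m then 1 else 0)"
    if "i < m" "j < m" "i \<noteq> j" for i j
    using adj nadj that by (auto simp: Int_commute)
  ultimately show ?thesis using that e by (auto simp: linear_cycle_family_def)
qed

text \<open>This reduces the search for a copy to finding a cyclic family of edges: the map given by
  the Venn regions carries \<open>C\<close> onto it, and down-closure of \<open>G\<close> supplies
  the images of smaller sets.\<close>

lemma contains_copy_downset_linear_cycle:
  assumes C: "is_linear_cycle k m C" and m: "m \<ge> 4" and G: "simplicial_complex G"
    and g: "linear_cycle_family k m g" and gE: "\<And>i. i < m \<Longrightarrow> g i \<in> edges G"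
  shows "contains_copy G (downset_complex C)"
proof -
  obtain e where e: "bij_betw e {..<m} (edges C)" "linear_cycle_family k m e"
    using is_linear_cycle_family[OF C] .
  obtain f where f: "inj_on f (\<Union>i\<in>{..<m}. e i)" "\<And>i. i \<in> {..<m} \<Longrightarrow> f ` e i = g i"
    using venn_isomorphism[of "{..<m}" e g] card_venn_region_linear_cycle_family[OF e(2) g m] e(2) g
    by (auto simp: linear_cycle_family_def)
  have vC: "verts C = (\<Union>i\<in>{..<m}. e i)"
    using C e(1) by (auto simp: is_linear_cycle_def bij_betw_def)
  have edge: "f ` d \<in> edges G" if "d \<in> edges C" for d
  proof -
    have "d \<in> e ` {..<m}" using e(1) that by (simp add: bij_betw_def)
    then obtain i where "i < m" "d = e i" by auto
    then show ?thesis using f(2)[of i] gE[of i] by simp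
  qed
  have down: "s \<in> edges G" if "s \<subseteq> d" "d \<in> edges G" for s d
    using G that by (auto simp: simplicial_complex_def)
  have img: "f ` verts C \<subseteq> verts G"
  proof -
    have "f ` verts C = (\<Union>i\<in>{..<m}. g i)" using f(2) unfolding vC by (simp add: image_UN)
    moreover have "edges G \<subseteq> Pow (verts G)" using G by (simp add: simplicial_complex_def hypergraph_def)
    ultimately show ?thesis using gE by blast
  qed
  have "f ` s \<in> edges G" if "s \<in> edges (downset_complex C)" for s
  proof -
    from that consider "s = {}" | v where "v \<in> verts C" "s = {v}" | d where "d \<in> edges C" "s \<subseteq> d"
      by (auto simp: downset_complex_def)
    then show ?thesis
    proof cases
      case 1
      then show ?thesis using G by (simp add: simplicial_complex_def)
    next
      case 2
      then show ?thesis using G img by (auto simp: simplicial_complex_def)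
    next
      case 3
      then show ?thesis using down[of "f ` s" "f ` d"] edge by blast
    qed
  qed
  moreover have "verts (downset_complex C) = verts C" by (simp add: downset_complex_def)
  ultimately show ?thesis using f(1) img unfolding contains_copy_def vC[symmetric] by metis
qed

lemma contains_copy_trans:
  assumes "contains_copy G H" "contains_copy H K"
  shows "contains_copy G K"
proof -
  obtain f where f: "inj_on f (verts H)" "f ` verts H \<subseteq> verts G" "\<forall>e\<in>edges H. f ` e \<in> edges G"
    using assms(1) by (auto simp: contains_copy_def)
  obtain h where h: "inj_on h (verts K)" "h ` verts K \<subseteq> verts H" "\<forall>e\<in>edges K. h ` e \<in> edges H"
    using assms(2) by (auto simp: contains_copy_def)
  have "inj_on (f \<circ> h) (verts K)" using comp_inj_on[OF h(1)] inj_on_subset[OF f(1) h(2)] by blast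
  moreover have "(f \<circ> h) ` verts K \<subseteq> verts G" using f(2) h(2) by fastforce
  moreover have "\<forall>e\<in>edges K. (f \<circ> h) ` e \<in> edges G" using f(3) h(3) by (metis image_comp)
  ultimately show ?thesis unfolding contains_copy_def by blast
qed

section \<open>Linear cycles in a tripartite configuration\<close>

text \<open>Edge \<open>j\<close> of the cycle to be built uses the \<open>x\<close>-vertex number \<open>zigzag t j\<close>, so that the edges
  \<open>2i - 1\<close> and \<open>2i\<close> (and the last and the first) meet there. The edges \<open>2i\<close> and \<open>2i + 1\<close> meet in
  their common colour if \<open>i < b\<close>, and in their \<open>y\<close>-vertex, which has number \<open>pair_index b j\<close>, otherwise.\<close>

definition zigzag :: "nat \<Rightarrow> nat \<Rightarrow> nat" where
  "zigzag t j = (Suc j div 2) mod t"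

definition pair_index :: "nat \<Rightarrow> nat \<Rightarrow> nat" where
  "pair_index b j = (if j < 2 * b then j else 2 * (j div 2))"

lemma zigzag_less: "t > 0 \<Longrightarrow> zigzag t j < t"
  by (simp add: zigzag_def)

lemma pair_index_less: "j < 2 * t \<Longrightarrow> pair_index b j < 2 * t"
  by (auto simp: pair_index_def)

lemma zigzag_eq: "j < 2 * t \<Longrightarrow> zigzag t j = (if j = 2 * t - 1 then 0 else Suc j div 2)"
  by (auto simp: zigzag_def)

lemma zigzag_eq_iff:
  assumes "i < j" "j < 2 * t"
  shows "zigzag t i = zigzag t j \<longleftrightarrow> (odd i \<and> j = Suc i) \<or> (i = 0 \<and> j = 2 * t - 1)"
proof -
  have i: "i < 2 * t" "i \<noteq> 2 * t - 1" using assms by simp_all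
  have d: "Suc i div 2 = Suc j div 2 \<longleftrightarrow> odd i \<and> j = Suc i" using assms(1) by presburger
  have odd: "odd (2 * t - 1)" using assms by simp
  show ?thesis
  proof (cases "j = 2 * t - 1")
    case True
    have "\<not> (odd i \<and> j = Suc i)" using odd True by (metis even_Suc)
    moreover have "Suc i div 2 = 0 \<longleftrightarrow> i = 0" by presburger
    ultimately show ?thesis
      unfolding zigzag_eq[OF i(1)] zigzag_eq[OF assms(2)] using i(2) True \<open>\<not> (odd i \<and> j = Suc i)\<close> by auto
  next
    case False
    then show ?thesis
      unfolding zigzag_eq[OF i(1)] zigzag_eq[OF assms(2)] using i(2) d by simp
  qed
qed

lemma pair_index_eq_iff:
  assumes "i < j"
  shows "pair_index b i = pair_index b j \<longleftrightarrow> 2 * b \<le> i \<and> i div 2 = j div 2"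
  using assms unfolding pair_index_def by (auto split: if_splits)

lemma cyclic_adjacent_iff:
  assumes "i < j" "j < 2 * t" "t \<ge> 2"
  shows "(j = Suc i mod (2 * t) \<or> i = Suc j mod (2 * t)) \<longleftrightarrow> j = Suc i \<or> (i = 0 \<and> j = 2 * t - 1)"
proof -
  have "i < 2 * t" using assms by simp
  then show ?thesis
    using assms unfolding eq_Suc_mod_iff[OF \<open>i < 2 * t\<close>] eq_Suc_mod_iff[OF assms(2)] by auto
qed

text \<open>The hypotheses keep the four kinds of vertices apart, so two edges can meet only in
  vertices of the same kind, and never in their \<open>zs\<close> parts. For neighbours on the cycle
  exactly one of x-vertex, y-vertex and colour agrees, for all other pairs none.\<close>

lemma assemble_linear_cycle:
  fixes xs ys :: "nat \<Rightarrow> 'v" and zs :: "nat \<Rightarrow> 'v set"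
  assumes t: "t \<ge> 2"
    and xs: "inj_on xs {..<2 * t}" and ys: "inj_on ys {..<2 * t}"
    and xy: "\<And>a b. a < 2 * t \<Longrightarrow> b < 2 * t \<Longrightarrow> xs a \<noteq> ys b"
    and xz: "\<And>a j. a < 2 * t \<Longrightarrow> j < 2 * t \<Longrightarrow> xs a \<notin> zs j"
    and yz: "\<And>a j. a < 2 * t \<Longrightarrow> j < 2 * t \<Longrightarrow> ys a \<notin> zs j"
    and zz: "\<And>i j. i < 2 * t \<Longrightarrow> j < 2 * t \<Longrightarrow> i \<noteq> j \<Longrightarrow> zs i \<inter> zs j = {}"
    and zs: "\<And>j. j < 2 * t \<Longrightarrow> finite (zs j) \<and> card (zs j) = q"
    and cx: "\<And>i a. i < 2 * t \<Longrightarrow> a < 2 * t \<Longrightarrow> c i \<noteq> xs a"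
    and cy: "\<And>i a. i < 2 * t \<Longrightarrow> a < 2 * t \<Longrightarrow> c i \<noteq> ys a"
    and cz: "\<And>i j. i < 2 * t \<Longrightarrow> j < 2 * t \<Longrightarrow> c i \<notin> zs j"
    and cc: "\<And>i j. i < j \<Longrightarrow> j < 2 * t \<Longrightarrow> c i = c j \<longleftrightarrow> j < 2 * b \<and> i div 2 = j div 2"
  shows "linear_cycle_family (q + 3) (2 * t)
    (\<lambda>j. insert (c j) (insert (xs (zigzag t j)) (insert (ys (pair_index b j)) (zs j))))"
    (is "linear_cycle_family _ _ ?g")
proof -
  have zig: "zigzag t j < 2 * t" for j using zigzag_less[of t j] t by simp
  have pi: "pair_index b j < 2 * t" if "j < 2 * t" for j using pair_index_less[OF that] .
  have card: "finite (?g i) \<and> card (?g i) = q + 3" if i: "i < 2 * t" for i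
  proof -
    have n: "c i \<noteq> xs (zigzag t i)" "c i \<noteq> ys (pair_index b i)" "xs (zigzag t i) \<noteq> ys (pair_index b i)"
      "c i \<notin> zs i" "xs (zigzag t i) \<notin> zs i" "ys (pair_index b i) \<notin> zs i"
      using cx[OF i zig] cy[OF i pi[OF i]] xy[OF zig pi[OF i]] cz[OF i i] xz[OF zig i] yz[OF pi[OF i] i] .
    then show ?thesis using zs[OF i] by simp
  qed
  have inter: "card (?g i \<inter> ?g j) = (if j = Suc i \<or> (i = 0 \<and> j = 2 * t - 1) then 1 else 0)"
    if ij: "i < j" "j < 2 * t" for i j
  proof -
    have i: "i < 2 * t" and j: "j < 2 * t" using ij by auto
    have eqs: "?g i \<inter> ?g j = (if zigzag t i = zigzag t j then {xs (zigzag t i)} else {}) \<union>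
       (if pair_index b i = pair_index b j then {ys (pair_index b i)} else {}) \<union>
       (if c i = c j then {c i} else {})"
      using cx[OF i zig[of j]] cx[OF j zig[of i]] cy[OF i pi[OF j]] cy[OF j pi[OF i]] cz[OF i j] cz[OF j i]
        xy[OF zig[of i] pi[OF j]] xy[OF zig[of j] pi[OF i]] xz[OF zig[of i] j] xz[OF zig[of j] i]
        yz[OF pi[OF i] j] yz[OF pi[OF j] i] zz[OF i j]
        inj_onD[OF xs, of "zigzag t i" "zigzag t j"] inj_onD[OF ys, of "pair_index b i" "pair_index b j"]
        zig[of i] zig[of j] pi[OF i] pi[OF j] ij(1)
      by auto
    have x: "zigzag t i = zigzag t j \<longleftrightarrow> (odd i \<and> j = Suc i) \<or> (i = 0 \<and> j = 2 * t - 1)"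
      using zigzag_eq_iff[OF ij] .
    have d: "i div 2 = j div 2 \<longleftrightarrow> even i \<and> j = Suc i" using ij(1) by presburger
    have b: "i < 2 * b \<longleftrightarrow> j < 2 * b" if "i div 2 = j div 2" using that by presburger
    \<comment> \<open>The first two cases are the pairs 2i, 2i + 1, meeting in a colour or in a
      y-vertex. The third case contains the pairs meeting in an x-vertex, including the closing pair
      0, 2t - 1.\<close>
    consider "i div 2 = j div 2" "j < 2 * b" | "i div 2 = j div 2" "\<not> j < 2 * b"
      | "i div 2 \<noteq> j div 2" "zigzag t i = zigzag t j" | "i div 2 \<noteq> j div 2" "zigzag t i \<noteq> zigzag t j"
      by blast
    then show ?thesis
    proof cases
      case 1
      then have "even i \<and> j = Suc i" using d by simp
      then have "zigzag t i \<noteq> zigzag t j" using x t by auto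
      moreover have "pair_index b i \<noteq> pair_index b j" using pair_index_eq_iff[OF ij(1)] 1 b by auto
      moreover have "c i = c j" using cc[OF ij] 1 by simp
      ultimately show ?thesis unfolding eqs using \<open>even i \<and> j = Suc i\<close> by simp
    next
      case 2
      then have "even i \<and> j = Suc i" using d by simp
      then have "zigzag t i \<noteq> zigzag t j" using x t by auto
      moreover have "pair_index b i = pair_index b j" using pair_index_eq_iff[OF ij(1)] 2 b by auto
      moreover have "c i \<noteq> c j" using cc[OF ij] 2 by simp
      ultimately show ?thesis unfolding eqs using \<open>even i \<and> j = Suc i\<close> by simp
    next
      case 3
      then have "pair_index b i \<noteq> pair_index b j" "c i \<noteq> c j"
        using pair_index_eq_iff[OF ij(1)] cc[OF ij] by auto
      then show ?thesis unfolding eqs using 3 x by auto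
    next
      case 4
      then have "pair_index b i \<noteq> pair_index b j" "c i \<noteq> c j"
        using pair_index_eq_iff[OF ij(1)] cc[OF ij] by auto
      then have "card (?g i \<inter> ?g j) = 0" unfolding eqs using 4 by simp
      moreover have "\<not> (j = Suc i \<or> (i = 0 \<and> j = 2 * t - 1))" using 4 x d by blast
      ultimately show ?thesis by simp
    qed
  qed
  have "card (?g i \<inter> ?g j) = (if j = Suc i mod (2 * t) \<or> i = Suc j mod (2 * t) then 1 else 0)"
    if "i < 2 * t" "j < 2 * t" "i \<noteq> j" for i j
  proof (cases "i < j")
    case True
    then show ?thesis using inter[OF True that(2)] cyclic_adjacent_iff[OF True that(2) t] by simp
  next
    case False
    then have ji: "j < i" using that(3) by simp
    have "(j = Suc i mod (2 * t) \<or> i = Suc j mod (2 * t)) \<longleftrightarrow> i = Suc j \<or> (j = 0 \<and> i = 2 * t - 1)"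
      using cyclic_adjacent_iff[OF ji that(1) t] by argo
    then show ?thesis using inter[OF ji that(1)] by (simp add: Int_commute)
  qed
  then show ?thesis using card unfolding linear_cycle_family_def by blast
qed

text \<open>\<open>L A\<close> is the list of \<open>t\<close> colours of a face \<open>A\<close>: vertices that extend \<open>A\<close> to an edge. \<open>C\<close> consists of
  the colours common to all faces. A configuration is a complete tripartite system of faces in which
  any two faces without a common index are disjoint and share no colour outside \<open>C\<close>.\<close>

definition admissible_edge :: "nat \<Rightarrow> nat \<Rightarrow> ('v set \<Rightarrow> 'v set) \<Rightarrow> 'v set \<Rightarrow> 'v \<Rightarrow> 'v \<Rightarrow> 'v set \<Rightarrow> bool" where
  "admissible_edge t q L C x y Z \<longleftrightarrow>
     x \<noteq> y \<and> x \<notin> Z \<and> y \<notin> Z \<and> finite Z \<and> card Z = q \<and>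
     L (insert x (insert y Z)) \<inter> insert x (insert y Z) = {} \<and>
     card (L (insert x (insert y Z))) = t \<and> C \<subseteq> L (insert x (insert y Z))"

text \<open>The middle clause is asymmetric; \<open>configuration\<close> ranges over ordered pairs
  of faces and so provides both directions.\<close>

definition conflict_free :: "('v set \<Rightarrow> 'v set) \<Rightarrow> 'v set \<Rightarrow> 'v set \<Rightarrow> 'v set \<Rightarrow> bool" where
  "conflict_free L C A A' \<longleftrightarrow> A \<inter> A' = {} \<and> L A \<inter> A' = {} \<and> L A \<inter> L A' \<subseteq> C"

definition configuration ::
  "nat \<Rightarrow> nat \<Rightarrow> nat \<Rightarrow> ('v set \<Rightarrow> 'v set) \<Rightarrow> 'v set \<Rightarrow>
     (nat \<Rightarrow> 'v) \<Rightarrow> (nat \<Rightarrow> 'v) \<Rightarrow> (nat \<Rightarrow> 'v set) \<Rightarrow> bool" where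
  "configuration s t q L C xs ys zs \<longleftrightarrow>
     (\<forall>a<s. \<forall>b<s. \<forall>j<s. admissible_edge t q L C (xs a) (ys b) (zs j)) \<and>
     (\<forall>a<s. \<forall>b<s. \<forall>j<s. \<forall>a'<s. \<forall>b'<s. \<forall>j'<s. a \<noteq> a' \<longrightarrow> b \<noteq> b' \<longrightarrow> j \<noteq> j' \<longrightarrow>
        conflict_free L C (insert (xs a) (insert (ys b) (zs j))) (insert (xs a') (insert (ys b') (zs j'))))"

lemma configuration_admissible:
  "\<lbrakk>configuration s t q L C xs ys zs; a < s; b < s; j < s\<rbrakk> \<Longrightarrow>
    admissible_edge t q L C (xs a) (ys b) (zs j)"
  by (simp add: configuration_def)

lemma configuration_conflict_free:
  "\<lbrakk>configuration s t q L C xs ys zs; a < s; b < s; j < s; a' < s; b' < s; j' < s;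
     a \<noteq> a'; b \<noteq> b'; j \<noteq> j'\<rbrakk> \<Longrightarrow>
    conflict_free L C (insert (xs a) (insert (ys b) (zs j))) (insert (xs a') (insert (ys b') (zs j')))"
  by (simp add: configuration_def)

lemma configuration_swap:
  assumes "configuration s t q L C xs ys zs"
  shows "configuration s t q L C ys xs zs"
proof -
  have c: "insert (ys b) (insert (xs a) Z) = insert (xs a) (insert (ys b) Z)" for a b Z by blast
  have "admissible_edge t q L C y x Z" if "admissible_edge t q L C x y Z" for x y Z
    using that unfolding admissible_edge_def insert_commute[of y x Z] by metis
  then show ?thesis using assms unfolding configuration_def c by simp
qed

lemma configuration_reindex:
  assumes "configuration s t q L C xs ys zs"
    and "inj_on p {..<s'}" "p ` {..<s'} \<subseteq> {..<s}"
    and "inj_on r {..<s'}" "r ` {..<s'} \<subseteq> {..<s}"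
    and "inj_on u {..<s'}" "u ` {..<s'} \<subseteq> {..<s}"
  shows "configuration s' t q L C (xs \<circ> p) (ys \<circ> r) (zs \<circ> u)"
proof -
  have m: "p i < s" "r i < s" "u i < s" if "i < s'" for i using assms that by auto
  have n: "p i \<noteq> p j" "r i \<noteq> r j" "u i \<noteq> u j" if "i < s'" "j < s'" "i \<noteq> j" for i j
    using assms(2,4,6) that by (auto simp: inj_on_def)
  show ?thesis unfolding configuration_def comp_def
    by (intro conjI allI impI configuration_admissible[OF assms(1)] configuration_conflict_free[OF assms(1)] m n)
qed

text \<open>Freedom from conflicts is known only for faces that differ in all three indices. To
  compare a vertex with the list of a face, it is completed to another face by changing the two
  remaining indices, for which \<open>s >= 2\<close> leaves room. Injectivity also has to be derived
  here, since the maps obtained by counting need not be injective.\<close>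

lemma configuration_vertices:
  assumes cf: "configuration s t q L C xs ys zs" and s: "s \<ge> 2"
  shows "inj_on xs {..<s}" "inj_on ys {..<s}"
    and "\<And>i j. i < s \<Longrightarrow> j < s \<Longrightarrow> i \<noteq> j \<Longrightarrow> zs i \<inter> zs j = {}"
    and "\<And>a b j a'. a < s \<Longrightarrow> b < s \<Longrightarrow> j < s \<Longrightarrow> a' < s \<Longrightarrow> xs a' \<notin> L (insert (xs a) (insert (ys b) (zs j)))"
    and "\<And>a b j a'. a < s \<Longrightarrow> b < s \<Longrightarrow> j < s \<Longrightarrow> a' < s \<Longrightarrow> ys a' \<notin> L (insert (xs a) (insert (ys b) (zs j)))"
    and "\<And>a b j j'. a < s \<Longrightarrow> b < s \<Longrightarrow> j < s \<Longrightarrow> j' < s \<Longrightarrow> zs j' \<inter> L (insert (xs a) (insert (ys b) (zs j))) = {}"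
proof -
  have ex: "\<exists>b<s. b \<noteq> a" for a :: nat using s by (cases "a = 0") (auto intro: exI[of _ 0] exI[of _ 1])
  let ?A = "\<lambda>a b j. insert (xs a) (insert (ys b) (zs j))"
  have own: "L (?A a b j) \<inter> ?A a b j = {}" if "a < s" "b < s" "j < s" for a b j
    using configuration_admissible[OF cf that] unfolding admissible_edge_def by blast
  have dis: "?A a b j \<inter> ?A a' b' j' = {}" "L (?A a b j) \<inter> ?A a' b' j' = {}"
    if "a < s" "b < s" "j < s" "a' < s" "b' < s" "j' < s" "a \<noteq> a'" "b \<noteq> b'" "j \<noteq> j'" for a b j a' b' j'
    using configuration_conflict_free[OF cf that] unfolding conflict_free_def by blast+
  show "inj_on xs {..<s}"
  proof (rule inj_onI, rule ccontr)
    fix a a' assume "a \<in> {..<s}" "a' \<in> {..<s}" "xs a = xs a'" "a \<noteq> a'"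
    then show False using dis(1)[of a 0 0 a' 1 1] s by auto
  qed
  show "inj_on ys {..<s}"
  proof (rule inj_onI, rule ccontr)
    fix a a' assume "a \<in> {..<s}" "a' \<in> {..<s}" "ys a = ys a'" "a \<noteq> a'"
    then show False using dis(1)[of 0 a 0 1 a' 1] s by auto
  qed
  show "zs i \<inter> zs j = {}" if "i < s" "j < s" "i \<noteq> j" for i j
    using dis(1)[of 0 0 i 1 1 j] s that by auto
  show "xs a' \<notin> L (?A a b j)" if "a < s" "b < s" "j < s" "a' < s" for a b j a'
  proof (cases "a' = a")
    case True
    then show ?thesis using own[OF that(1-3)] by blast
  next
    case False
    obtain b' j' where "b' < s" "b' \<noteq> b" "j' < s" "j' \<noteq> j" using ex by metis
    then show ?thesis using dis(2)[of a b j a' b' j'] that False by blast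
  qed
  show "ys a' \<notin> L (?A a b j)" if "a < s" "b < s" "j < s" "a' < s" for a b j a'
  proof (cases "a' = b")
    case True
    then show ?thesis using own[OF that(1-3)] by blast
  next
    case False
    obtain b' j' where "b' < s" "b' \<noteq> a" "j' < s" "j' \<noteq> j" using ex by metis
    then show ?thesis using dis(2)[of a b j b' a' j'] that False by blast
  qed
  show "zs j' \<inter> L (?A a b j) = {}" if "a < s" "b < s" "j < s" "j' < s" for a b j j'
  proof (cases "j' = j")
    case True
    then show ?thesis using own[OF that(1-3)] by blast
  next
    case False
    obtain a' b' where "b' < s" "b' \<noteq> b" "a' < s" "a' \<noteq> a" using ex by metis
    then show ?thesis using dis(2)[of a b j a' b' j'] that False by blast
  qed
qed

text \<open>The first \<open>b\<close> pairs meet in common colours given by \<open>col\<close>;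
  every later edge takes a light colour \<open>l j\<close>, that is, one outside \<open>C\<close>.
  Edges that are not neighbours differ in all three indices, so their light colours differ
  automatically. What \<open>adj\<close> adds is the neighbours, where the closing pair matters only
  for b = 0 because otherwise edge 0 has a colour from \<open>C\<close>.\<close>

lemma configuration_colored_cycle:
  assumes cf: "configuration s t q L C xs ys zs" and t: "t \<ge> 2" and s: "s \<ge> 2 * t" and b: "b \<le> t"
    and col: "inj_on col {..<b}" "col ` {..<b} \<subseteq> C"
    and l: "\<And>j. 2 * b \<le> j \<Longrightarrow> j < 2 * t \<Longrightarrow>
       l j \<in> L (insert (xs (zigzag t j)) (insert (ys (pair_index b j)) (zs j))) - C"
    and adj: "\<And>i. 2 * b \<le> i \<Longrightarrow> Suc i < 2 * t \<Longrightarrow> l i \<noteq> l (Suc i)" "b = 0 \<Longrightarrow> l 0 \<noteq> l (2 * t - 1)"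
  shows "\<exists>g. linear_cycle_family (q + 3) (2 * t) g \<and>
    (\<forall>i<2 * t. \<exists>a<s. \<exists>b<s. \<exists>j<s. \<exists>v\<in>L (insert (xs a) (insert (ys b) (zs j))).
       g i = insert v (insert (xs a) (insert (ys b) (zs j))))"
proof -
  let ?A = "\<lambda>j. insert (xs (zigzag t j)) (insert (ys (pair_index b j)) (zs j))"
  define c where "c = (\<lambda>j. if j < 2 * b then col (j div 2) else l j)"
  have s2: "s \<ge> 2" using s t by simp
  note V = configuration_vertices[OF cf s2]
  have zig: "zigzag t j < s" for j using zigzag_less[of t j] t s by simp
  have pi: "pair_index b j < s" if "j < 2 * t" for j using pair_index_less[OF that] s by (rule order.strict_trans2)
  have basic: "xs a \<noteq> ys b" "xs a \<notin> zs j" "ys b \<notin> zs j" "finite (zs j)" "card (zs j) = q"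
      "C \<subseteq> L (insert (xs a) (insert (ys b) (zs j)))" if "a < s" "b < s" "j < s" for a b j
    using configuration_admissible[OF cf that] unfolding admissible_edge_def by simp_all
  have c_L: "c j \<in> L (?A j)" if j: "j < 2 * t" for j
  proof (cases "j < 2 * b")
    case True
    then have "c j \<in> C" using col(2) by (auto simp: c_def)
    then show ?thesis using basic(6)[OF zig pi[OF j], of j] j s by auto
  next
    case False
    then show ?thesis using l[of j] j by (simp add: c_def)
  qed
  have far: "l i \<noteq> l j" if "2 * b \<le> i" "i < j" "j < 2 * t" for i j
  proof (cases "zigzag t i = zigzag t j \<or> pair_index b i = pair_index b j")
    case True
    moreover have "i div 2 = j div 2 \<Longrightarrow> j = Suc i" using that(2) by presburger
    ultimately have "j = Suc i \<or> (i = 0 \<and> j = 2 * t - 1)"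
      using zigzag_eq_iff[OF that(2,3)] pair_index_eq_iff[OF that(2), of b] by blast
    then show ?thesis using adj that by auto
  next
    case False
    have lt: "zigzag t i < s" "zigzag t j < s" "pair_index b i < s" "pair_index b j < s" "i < s" "j < s"
      using zig pi[of i] pi[of j] that s by auto
    have "L (?A i) \<inter> L (?A j) \<subseteq> C"
      using configuration_conflict_free[OF cf lt(1,3,5) lt(2,4,6)] False that(2) unfolding conflict_free_def by simp
    then show ?thesis using l[of i] l[of j] that by auto
  qed
  have cc: "c i = c j \<longleftrightarrow> j < 2 * b \<and> i div 2 = j div 2" if "i < j" "j < 2 * t" for i j
  proof -
    consider "j < 2 * b" | "i < 2 * b" "\<not> j < 2 * b" | "\<not> i < 2 * b" "\<not> j < 2 * b"
      using that by linarith
    then show ?thesis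
    proof cases
      case 1
      then have "i div 2 < b" "j div 2 < b" using that by auto
      then have "col (i div 2) = col (j div 2) \<longleftrightarrow> i div 2 = j div 2"
        using col(1) by (auto simp: inj_on_def)
      then show ?thesis using 1 that by (simp add: c_def)
    next
      case 2
      then have "c i \<in> C" using col(2) by (auto simp: c_def)
      moreover have "c j \<notin> C" using 2 l[of j] that by (simp add: c_def)
      ultimately show ?thesis using 2 by auto
    next
      case 3
      then show ?thesis using far[of i j] that by (simp add: c_def)
    qed
  qed
  have sub: "a < s" if "a < 2 * t" for a using that s by simp
  have "linear_cycle_family (q + 3) (2 * t) (\<lambda>j. insert (c j) (?A j))"
  proof (rule assemble_linear_cycle[OF t, where b = b])
    show "inj_on xs {..<2 * t}" "inj_on ys {..<2 * t}"
      using inj_on_subset[OF V(1)] inj_on_subset[OF V(2)] s by auto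
    show "c i \<noteq> xs a" if "i < 2 * t" "a < 2 * t" for i a
      using c_L[OF that(1)] V(4)[OF zig pi[OF that(1)] sub[OF that(1)] sub[OF that(2)]] by metis
    show "c i \<noteq> ys a" if "i < 2 * t" "a < 2 * t" for i a
      using c_L[OF that(1)] V(5)[OF zig pi[OF that(1)] sub[OF that(1)] sub[OF that(2)]] by metis
    show "c i \<notin> zs a" if "i < 2 * t" "a < 2 * t" for i a
      using c_L[OF that(1)] V(6)[OF zig pi[OF that(1)] sub[OF that(1)] sub[OF that(2)]] by blast
    show "xs a \<noteq> ys a'" if "a < 2 * t" "a' < 2 * t" for a a'
      using basic(1)[OF sub[OF that(1)] sub[OF that(2)] sub[OF that(2)]] .
    show "xs a \<notin> zs j" "ys a \<notin> zs j" if "a < 2 * t" "j < 2 * t" for a j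
      using basic(2,3)[OF sub[OF that(1)] sub[OF that(1)] sub[OF that(2)]] by auto
    show "finite (zs j) \<and> card (zs j) = q" if "j < 2 * t" for j
      using basic(4,5)[OF sub[OF that] sub[OF that] sub[OF that]] by simp
    show "zs i \<inter> zs j = {}" if "i < 2 * t" "j < 2 * t" "i \<noteq> j" for i j
      using V(3)[OF sub[OF that(1)] sub[OF that(2)] that(3)] .
    show "c i = c j \<longleftrightarrow> j < 2 * b \<and> i div 2 = j div 2" if "i < j" "j < 2 * t" for i j
      using cc[OF that] .
  qed
  moreover have "\<exists>a<s. \<exists>b'<s. \<exists>j<s. \<exists>v\<in>L (insert (xs a) (insert (ys b') (zs j))).
       insert (c i) (?A i) = insert v (insert (xs a) (insert (ys b') (zs j)))" if "i < 2 * t" for i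
    using zig[of i] pi[OF that] sub[OF that] c_L[OF that] by blast
  ultimately show ?thesis by blast
qed

text \<open>A colour common to the two ends of the path is forbidden at position \<open>m - 2\<close> by the
  disjointness assumption, so using it at position \<open>m - 1\<close> closes the path.\<close>

lemma cyclic_choice:
  fixes M :: "nat \<Rightarrow> 'a set"
  assumes m: "m \<ge> 4" and M: "\<And>j. j < m \<Longrightarrow> card (M j) \<ge> 2" and dis: "M 0 \<inter> M (m - 2) = {}"
  shows "\<exists>l. (\<forall>j<m. l j \<in> M j) \<and> (\<forall>j. Suc j < m \<longrightarrow> l j \<noteq> l (Suc j)) \<and> l 0 \<noteq> l (m - 1)"
proof -
  have ex: "\<exists>v. v \<in> M j \<and> v \<noteq> p" if "j < m" for j p
  proof (rule ccontr)
    assume "\<nexists>v. v \<in> M j \<and> v \<noteq> p"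
    then have "M j \<subseteq> {p}" by blast
    then have "card (M j) \<le> card {p}" by (rule card_mono[rotated]) simp
    then show False using M[OF that] by simp
  qed
  have path: "\<exists>f. f 0 = a \<and> (\<forall>j<m. f j \<in> M j) \<and> (\<forall>j. Suc j < m \<longrightarrow> f j \<noteq> f (Suc j))"
    if a: "a \<in> M 0" for a
  proof -
    obtain nx where nx: "\<And>j p. j < m \<Longrightarrow> nx j p \<in> M j \<and> nx j p \<noteq> p" using ex by metis
    define f where "f = rec_nat a (\<lambda>j p. nx (Suc j) p)"
    have f: "f 0 = a" "\<And>j. f (Suc j) = nx (Suc j) (f j)" by (simp_all add: f_def)
    have "f j \<in> M j" if "j < m" for j using that a nx f by (cases j) auto
    moreover have "f j \<noteq> f (Suc j)" if "Suc j < m" for j using nx[OF that] f(2)[of j] by metis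
    ultimately show ?thesis using f(1) by blast
  qed
  show ?thesis
  proof (cases "M 0 \<inter> M (m - 1) = {}")
    case True
    obtain a where "a \<in> M 0" using ex[of 0] m by auto
    then obtain f where f: "f 0 = a" "\<forall>j<m. f j \<in> M j" "\<forall>j. Suc j < m \<longrightarrow> f j \<noteq> f (Suc j)"
      using path by blast
    moreover have "f 0 \<noteq> f (m - 1)" using True f(2) m by (metis disjoint_iff diff_less less_le_trans zero_less_numeral zero_less_one)
    ultimately show ?thesis by blast
  next
    case False
    then obtain c where c: "c \<in> M 0" "c \<in> M (m - 1)" by blast
    obtain a where a: "a \<in> M 0" "a \<noteq> c" using ex[of 0] m by auto
    then obtain f where f: "f 0 = a" "\<forall>j<m. f j \<in> M j" "\<forall>j. Suc j < m \<longrightarrow> f j \<noteq> f (Suc j)"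
      using path by blast
    define l where "l = f(m - 1 := c)"
    have "\<forall>j<m. l j \<in> M j" using f(2) c(2) by (simp add: l_def)
    moreover have "l j \<noteq> l (Suc j)" if "Suc j < m" for j
    proof (cases "Suc j = m - 1")
      case True
      then have "j = m - 2" "j \<noteq> m - 1" by auto
      then have "l j \<in> M (m - 2)" using f(2) that by (simp add: l_def)
      then show ?thesis using True c(1) dis by (auto simp: l_def)
    next
      case False
      moreover have "j \<noteq> m - 1" using that by linarith
      ultimately show ?thesis using f(3) that by (simp add: l_def)
    qed
    moreover have "l 0 \<noteq> l (m - 1)" using f(1) a m by (simp add: l_def)
    ultimately show ?thesis by blast
  qed
qed

text \<open>With \<open>b = t - 1\<close> just the last pair of edges takes light colours, and each
  list has exactly one. Two different colours would complete a cycle, so their equality is the only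
  obstruction. The faces named are those at positions 2t - 2 and 2t - 1.\<close>

lemma configuration_light_pair:
  fixes xs ys :: "nat \<Rightarrow> 'v"
  assumes cf: "configuration s t q L C xs ys zs" and t: "t \<ge> 2" and s: "s \<ge> 2 * t"
    and C: "card C = t - 1"
    and neg: "\<not> (\<exists>g. linear_cycle_family (q + 3) (2 * t) g \<and>
      (\<forall>i<2 * t. \<exists>a<s. \<exists>b<s. \<exists>j<s. \<exists>v\<in>L (insert (xs a) (insert (ys b) (zs j))).
         g i = insert v (insert (xs a) (insert (ys b) (zs j)))))"
  shows "L (insert (xs (t - 1)) (insert (ys (2 * t - 2)) (zs (2 * t - 2)))) - C =
    L (insert (xs 0) (insert (ys (2 * t - 2)) (zs (2 * t - 1)))) - C"
proof -
  let ?M = "\<lambda>j. L (insert (xs (zigzag t j)) (insert (ys (pair_index (t - 1) j)) (zs j))) - C"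
  have fC: "finite C" using C t by (intro card_ge_0_finite) simp
  obtain col where "bij_betw col {..<t - 1} C"
    using ex_bij_betw_nat_finite[OF fC] C by (auto simp: atLeast0LessThan)
  then have col: "inj_on col {..<t - 1}" "col ` {..<t - 1} \<subseteq> C" by (auto simp: bij_betw_def)
  have M: "card (?M j) = 1" if j: "j < 2 * t" for j
  proof -
    have "zigzag t j < s" "pair_index (t - 1) j < s" "j < s"
      using zigzag_less[of t j] pair_index_less[OF j, of "t - 1"] t s j by auto
    then have "admissible_edge t q L C (xs (zigzag t j)) (ys (pair_index (t - 1) j)) (zs j)"
      by (rule configuration_admissible[OF cf])
    then show ?thesis using card_Diff_subset[OF fC] C t unfolding admissible_edge_def by auto
  qed
  have single: "S = {v}" if "card S = 1" "v \<in> S" for S :: "'v set" and v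
    using that by (metis card_1_singletonE singletonD)
  have "\<exists>v. v \<in> ?M j" if "j < 2 * t" for j using M[OF that] by (metis card_1_singletonE insertI1)
  then obtain l where l: "\<And>j. j < 2 * t \<Longrightarrow> l j \<in> ?M j" by metis
  have eq: "l (2 * t - 2) = l (2 * t - 1)"
  proof (rule ccontr)
    assume ne: "l (2 * t - 2) \<noteq> l (2 * t - 1)"
    have "l i \<noteq> l (Suc i)" if "2 * (t - 1) \<le> i" "Suc i < 2 * t" for i
    proof -
      have "i = 2 * t - 2" "Suc i = 2 * t - 1" using that by auto
      then show ?thesis using ne by simp
    qed
    then show False
      using configuration_colored_cycle[OF cf t s _ col, of l] neg l t by auto
  qed
  have "?M (2 * t - 2) = {l (2 * t - 2)}" "?M (2 * t - 1) = {l (2 * t - 1)}"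
    using single[OF M l, of "2 * t - 2"] single[OF M l, of "2 * t - 1"] t by auto
  moreover have "zigzag t (2 * t - 2) = t - 1" "zigzag t (2 * t - 1) = 0"
    using t by (auto simp: zigzag_eq)
  moreover have "pair_index (t - 1) (2 * t - 2) = 2 * t - 2" "pair_index (t - 1) (2 * t - 1) = 2 * t - 2"
    using t unfolding pair_index_def by auto
  ultimately show ?thesis using eq by simp
qed

lemma configuration_cycle:
  assumes cf: "configuration s t q L C xs ys zs" and t: "t \<ge> 2" and s: "s \<ge> 3 * t"
  shows "\<exists>g. linear_cycle_family (q + 3) (2 * t) g \<and>
    (\<forall>i<2 * t. \<exists>a<s. \<exists>b<s. \<exists>j<s. \<exists>v\<in>L (insert (xs a) (insert (ys b) (zs j))).
       g i = insert v (insert (xs a) (insert (ys b) (zs j))))"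
proof -
  let ?A = "\<lambda>a b j. insert (xs a) (insert (ys b) (zs j))"
  have s2: "s \<ge> 2 * t" using s by simp
  have L: "C \<subseteq> L (?A a b j)" "card (L (?A a b j)) = t" "finite (L (?A a b j))"
    if "a < s" "b < s" "j < s" for a b j
  proof -
    show "C \<subseteq> L (?A a b j)" "card (L (?A a b j)) = t" using configuration_admissible[OF cf that] unfolding admissible_edge_def by simp_all
    then show "finite (L (?A a b j))" using t card.infinite by fastforce
  qed
  have LC: "L (?A a b j) \<inter> L (?A a' b' j') \<subseteq> C"
    if "a < s" "b < s" "j < s" "a' < s" "b' < s" "j' < s" "a \<noteq> a'" "b \<noteq> b'" "j \<noteq> j'" for a b j a' b' j'
    using configuration_conflict_free[OF cf that] unfolding conflict_free_def by blast
  have "0 < s" using s t by simp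
  have fC: "finite C" and C: "card C \<le> t"
    using L[OF \<open>0 < s\<close> \<open>0 < s\<close> \<open>0 < s\<close>] card_mono finite_subset by metis+
  have card_L: "card (L (?A a b j) - C) = t - card C" if "a < s" "b < s" "j < s" for a b j
    using L[OF that] card_Diff_subset[OF fC] by metis
  obtain col where col: "bij_betw col {..<card C} C"
    using ex_bij_betw_nat_finite[OF fC] by (auto simp: atLeast0LessThan)
  have colb: "inj_on col {..<b}" "col ` {..<b} \<subseteq> C" if "b \<le> card C" for b
    using col that by (auto simp: bij_betw_def inj_on_def)
  have zig: "zigzag t j < s" for j using zigzag_less[of t j] t s by simp
  have pi: "pair_index b j < s" if "j < 2 * t" for j b using pair_index_less[OF that] s2 by (rule order.strict_trans2)
  consider "card C = t" | "card C = t - 1" | "card C \<le> t - 2" using C by linarith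
  then show ?thesis
  proof cases
    case 1
    show ?thesis
      by (rule configuration_colored_cycle[OF cf t s2 order_refl, where col = col]) (use colb 1 t in auto)
  next
    case 2
    show ?thesis
    proof (rule ccontr)
      assume neg: "\<not> ?thesis"
      \<comment> \<open>Without a cycle, the light colour is constant both along pairs sharing their \<open>y\<close>-vertex
        and along pairs sharing their \<open>x\<close>-vertex, hence it agrees on two disjoint edges.\<close>
      have y: "L (?A (t - 1) (2 * t - 2) (2 * t - 2)) - C = L (?A 0 (2 * t - 2) (2 * t - 1)) - C"
        using configuration_light_pair[OF cf t s2 2 neg] .
      have x: "L (?A 0 (2 * t - 2) (2 * t - 1)) - C = L (?A 0 (t - 1) (2 * t)) - C"
      proof -
        \<comment> \<open>The same lemma is applied with x and y exchanged. \<open>r\<close> and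
          \<open>Suc\<close> are chosen so that its first face is the second face of
          \<open>y\<close>; its second face then has indices 0, t - 1, 2t, all different from those
          of the first face of \<open>y\<close>. The shift by t - 1 reaches index 3t - 2, which
          accounts for a configuration of size 3t.\<close>
        define p where "p = (\<lambda>j. j + (t - 1))"
        define r where "r = (\<lambda>j. if j = 0 then 2 * t - 2 else if j = 2 * t - 2 then 0 else j)"
        have "configuration (2 * t) t q L C (ys \<circ> p) (xs \<circ> r) (zs \<circ> Suc)"
        proof (rule configuration_reindex[OF configuration_swap[OF cf]])
          show "inj_on p {..<2 * t}" by (simp add: inj_on_def p_def)
          show "inj_on r {..<2 * t}" by (auto simp: inj_on_def r_def split: if_splits)
        qed (use s t in \<open>auto simp: p_def r_def\<close>)
        moreover have "\<not> (\<exists>g. linear_cycle_family (q + 3) (2 * t) g \<and>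
          (\<forall>i<2 * t. \<exists>a<2 * t. \<exists>b<2 * t. \<exists>j<2 * t.
             \<exists>v\<in>L (insert ((ys \<circ> p) a) (insert ((xs \<circ> r) b) ((zs \<circ> Suc) j))).
             g i = insert v (insert ((ys \<circ> p) a) (insert ((xs \<circ> r) b) ((zs \<circ> Suc) j)))))"
        proof
          assume "\<exists>g. linear_cycle_family (q + 3) (2 * t) g \<and>
          (\<forall>i<2 * t. \<exists>a<2 * t. \<exists>b<2 * t. \<exists>j<2 * t.
             \<exists>v\<in>L (insert ((ys \<circ> p) a) (insert ((xs \<circ> r) b) ((zs \<circ> Suc) j))).
             g i = insert v (insert ((ys \<circ> p) a) (insert ((xs \<circ> r) b) ((zs \<circ> Suc) j))))"
          then obtain g where g: "linear_cycle_family (q + 3) (2 * t) g"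
            "\<forall>i<2 * t. \<exists>a<2 * t. \<exists>b<2 * t. \<exists>j<2 * t.
             \<exists>v\<in>L (?A (r b) (p a) (Suc j)). g i = insert v (?A (r b) (p a) (Suc j))"
            unfolding comp_def insert_commute[of "ys _" "xs _" "zs _"] by blast
          have "p a < s" "r a < s" "Suc a < s" if "a < 2 * t" for a
            using that s t by (auto simp: p_def r_def)
          then have "\<forall>i<2 * t. \<exists>a<s. \<exists>b<s. \<exists>j<s. \<exists>v\<in>L (?A a b j). g i = insert v (?A a b j)"
            using g(2) by meson
          then show False using neg g(1) by blast
        qed
        ultimately have "L (insert ((ys \<circ> p) (t - 1)) (insert ((xs \<circ> r) (2 * t - 2)) ((zs \<circ> Suc) (2 * t - 2)))) - C =
            L (insert ((ys \<circ> p) 0) (insert ((xs \<circ> r) (2 * t - 2)) ((zs \<circ> Suc) (2 * t - 1)))) - C"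
          using configuration_light_pair[of "2 * t" t q L C "ys \<circ> p" "xs \<circ> r" "zs \<circ> Suc"] t 2 by blast
        moreover have "p (t - 1) = 2 * t - 2" "p 0 = t - 1" "r (2 * t - 2) = 0"
          "Suc (2 * t - 2) = 2 * t - 1" "Suc (2 * t - 1) = 2 * t"
          using t by (auto simp: p_def r_def)
        ultimately show ?thesis by (simp add: insert_commute del: Suc_diff_le)
      qed
      have "L (?A (t - 1) (2 * t - 2) (2 * t - 2)) \<inter> L (?A 0 (t - 1) (2 * t)) \<subseteq> C"
        using LC[of "t - 1" "2 * t - 2" "2 * t - 2" 0 "t - 1" "2 * t"] t s by auto
      then have "L (?A (t - 1) (2 * t - 2) (2 * t - 2)) - C = {}" using x y by blast
      moreover have "card (L (?A (t - 1) (2 * t - 2) (2 * t - 2)) - C) = 1"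
        using card_L[of "t - 1" "2 * t - 2" "2 * t - 2"] 2 t s by simp
      ultimately show False by (metis card.empty zero_neq_one)
    qed
  next
    case 3
    \<comment> \<open>With b = 0 all edges meet in x- and y-vertices and all colours are light.
      Faces 0 and 2t - 2 differ in all three indices, which is the disjointness that
      \<open>cyclic_choice\<close> asks for.\<close>
    define M where "M = (\<lambda>j. L (?A (zigzag t j) (pair_index 0 j) j) - C)"
    have "card (M j) \<ge> 2" if "j < 2 * t" for j
      using card_L[OF zig pi[OF that], of j] that s2 3 t by (simp add: M_def)
    moreover have "M 0 \<inter> M (2 * t - 2) = {}"
    proof -
      have "zigzag t 0 \<noteq> zigzag t (2 * t - 2)" "pair_index 0 0 \<noteq> pair_index 0 (2 * t - 2)"
        using zigzag_eq_iff[of 0 "2 * t - 2" t] pair_index_eq_iff[of 0 "2 * t - 2" 0] t by auto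
      moreover have "2 * t - 2 < s" using t s by linarith
      ultimately show ?thesis
        using LC[OF zig[of 0] pi[of 0 0] _ zig[of "2 * t - 2"] pi[of "2 * t - 2" 0], of 0 "2 * t - 2"] t s
        by (auto simp: M_def)
    qed
    moreover have "4 \<le> 2 * t" using t by simp
    ultimately obtain l where l: "\<forall>j<2 * t. l j \<in> M j" "\<forall>j. Suc j < 2 * t \<longrightarrow> l j \<noteq> l (Suc j)" "l 0 \<noteq> l (2 * t - 1)"
      using cyclic_choice[of "2 * t" M] by blast
    show ?thesis
      by (rule configuration_colored_cycle[OF cf t s2, where b = 0 and col = col and l = l])
        (use l in \<open>auto simp: M_def\<close>)
  qed
qed

section \<open>Counting complete tripartite systems\<close>

text \<open>The tangent line to the power function replaces Jensen's inequality in the next lemma.\<close>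

lemma power_tangent:
  fixes d m :: real
  assumes "m > 0" "d \<ge> 0"
  shows "m ^ s * (1 + real s * (d / m - 1)) \<le> d ^ s"
proof -
  have "1 + real s * (d / m - 1) \<le> (1 + (d / m - 1)) ^ s"
    using assms by (intro Bernoulli_inequality) simp
  also have "\<dots> = (d / m) ^ s" by simp
  finally have "m ^ s * (1 + real s * (d / m - 1)) \<le> m ^ s * (d / m) ^ s"
    using assms by (intro mult_left_mono) auto
  then show ?thesis using assms by (simp add: power_divide)
qed

text \<open>Replacing one coordinate by an s-tuple turns density \<delta> into \<delta>^s, because
  the count is the sum of the s-th powers of the fibre sizes and the power function is
  convex.\<close>

lemma card_power_fibres:
  fixes \<delta> :: real
  assumes X: "finite X" and Y: "finite Y" and S: "S \<subseteq> X \<times> Y" and \<delta>: "\<delta> > 0"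
    and card: "real (card S) \<ge> \<delta> * (real (card X) * real (card Y))"
  shows "real (card {(f, y). f \<in> {..<s} \<rightarrow>\<^sub>E X \<and> y \<in> Y \<and> (\<forall>i<s. (f i, y) \<in> S)})
    \<ge> \<delta> ^ s * (real (card X) ^ s * real (card Y))"
proof (cases "X = {}")
  case True
  show ?thesis
  proof (cases "s = 0")
    case True
    have "{(f, y). f \<in> {..<s} \<rightarrow>\<^sub>E X \<and> y \<in> Y \<and> (\<forall>i<s. (f i, y) \<in> S)} = {\<lambda>x. undefined} \<times> Y"
      using True by auto
    then show ?thesis using True by (simp add: card_cartesian_product)
  next
    case False
    then show ?thesis using True by (simp add: power_0_left)
  qed
next
  case False
  define fib where "fib = (\<lambda>y. {x \<in> X. (x, y) \<in> S})"
  define m where "m = \<delta> * real (card X)"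
  have m: "m > 0" using False X \<delta> by (simp add: m_def card_gt_0_iff)
  have ffib: "finite (fib y)" for y using X by (simp add: fib_def)
  have "S = (\<lambda>(y, x). (x, y)) ` (SIGMA y:Y. fib y)" using S by (auto simp: fib_def)
  then have "card S = card ((\<lambda>(y, x). (x, y)) ` (SIGMA y:Y. fib y))" by simp
  also have "\<dots> = card (SIGMA y:Y. fib y)" by (rule card_image) (auto simp: inj_on_def)
  finally have "card S = card (SIGMA y:Y. fib y)" .
  then have cS: "real (card S) = (\<Sum>y\<in>Y. real (card (fib y)))"
    using card_SigmaI[OF Y, of fib] ffib by simp
  let ?H = "{(f, y). f \<in> {..<s} \<rightarrow>\<^sub>E X \<and> y \<in> Y \<and> (\<forall>i<s. (f i, y) \<in> S)}"
  have H_eq: "?H = (\<lambda>(y, f). (f, y)) ` (SIGMA y:Y. {..<s} \<rightarrow>\<^sub>E fib y)"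
    by (fastforce simp: fib_def PiE_iff)
  have "card ?H = card (SIGMA y:Y. {..<s} \<rightarrow>\<^sub>E fib y)"
    unfolding H_eq by (rule card_image) (auto simp: inj_on_def)
  also have "\<dots> = (\<Sum>y\<in>Y. card (fib y) ^ s)"
    using card_SigmaI[OF Y, of "\<lambda>y. {..<s} \<rightarrow>\<^sub>E fib y"] ffib
    by (simp add: card_funcsetE finite_PiE)
  finally have cH: "real (card ?H) = (\<Sum>y\<in>Y. real (card (fib y)) ^ s)" by simp
  have "m * real (card Y) \<le> real (card S)" using card by (simp add: m_def mult.assoc)
  then have "real (card Y) \<le> real (card S) / m" using m by (simp add: pos_le_divide_eq mult.commute)
  \<comment> \<open>The tangent is taken at \<open>m\<close>, a lower bound for the average fibre
    size, so the linear terms add up to a nonnegative amount.\<close>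
  then have "m ^ s * real (card Y) \<le> m ^ s * (real (card Y) + real s * (real (card S) / m - real (card Y)))"
    using m by (intro mult_left_mono) auto
  also have "\<dots> = (\<Sum>y\<in>Y. m ^ s * (1 + real s * (real (card (fib y)) / m - 1)))"
    unfolding cS by (simp add: sum_distrib_left[symmetric] sum.distrib sum_subtractf sum_divide_distrib)
  also have "\<dots> \<le> (\<Sum>y\<in>Y. real (card (fib y)) ^ s)"
    by (intro sum_mono power_tangent m) simp
  finally show ?thesis unfolding cH by (simp add: m_def power_mult_distrib mult.assoc)
qed

text \<open>The blow-up is applied to the coordinates x, y and z in turn, which multiplies the
  exponent by s three times. \<open>T1'\<close> and \<open>T2'\<close> merely bring the next
  coordinate to the front.\<close>

lemma card_homs_complete_tripartite:
  fixes \<delta> :: real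
  assumes X: "finite X" and Y: "finite Y" and Z: "finite Z" and T: "T \<subseteq> X \<times> Y \<times> Z" and \<delta>: "\<delta> > 0"
    and card: "real (card T) \<ge> \<delta> * (real (card X) * real (card Y) * real (card Z))"
  shows "real (card {(f, g, h). f \<in> {..<s} \<rightarrow>\<^sub>E X \<and> g \<in> {..<s} \<rightarrow>\<^sub>E Y \<and> h \<in> {..<s} \<rightarrow>\<^sub>E Z \<and>
      (\<forall>a<s. \<forall>b<s. \<forall>j<s. (f a, g b, h j) \<in> T)})
    \<ge> \<delta> ^ (s ^ 3) * (real (card X) * real (card Y) * real (card Z)) ^ s"
proof -
  define F where "F = ({..<s} \<rightarrow>\<^sub>E X)"
  define G where "G = ({..<s} \<rightarrow>\<^sub>E Y)"
  have F: "finite F" "card F = card X ^ s" using X by (auto simp: F_def finite_PiE card_funcsetE)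
  have G: "finite G" "card G = card Y ^ s" using Y by (auto simp: G_def finite_PiE card_funcsetE)
  define T1 where "T1 = {(f, y, z). f \<in> F \<and> (y, z) \<in> Y \<times> Z \<and> (\<forall>i<s. (f i, y, z) \<in> T)}"
  have "real (card T1) \<ge> \<delta> ^ s * (real (card X) ^ s * real (card (Y \<times> Z)))"
    using card_power_fibres[OF X finite_cartesian_product[OF Y Z] T \<delta>, of s] card
    unfolding T1_def F_def card_cartesian_product by (simp add: mult.assoc case_prod_unfold mem_Times_iff)
  moreover define T1' where "T1' = {(y, f, z). (f, y, z) \<in> T1}"
  have "T1' = (\<lambda>(f, y, z). (y, f, z)) ` T1" by (force simp: T1'_def)
  then have "card T1' = card T1" by (simp only:) (rule card_image, auto simp: inj_on_def)
  ultimately have c1: "real (card T1') \<ge> \<delta> ^ s * (real (card Y) * real (card (F \<times> Z)))"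
    by (simp add: F(2) card_cartesian_product mult_ac)
  have s1: "T1' \<subseteq> Y \<times> (F \<times> Z)" by (auto simp: T1'_def T1_def)
  define T2 where "T2 = {(g, f, z). g \<in> G \<and> (f, z) \<in> F \<times> Z \<and> (\<forall>i<s. (g i, f, z) \<in> T1')}"
  have "real (card T2) \<ge> (\<delta> ^ s) ^ s * (real (card Y) ^ s * real (card (F \<times> Z)))"
    using card_power_fibres[OF Y finite_cartesian_product[OF F(1) Z] s1 _ c1, of s] \<delta>
    unfolding T2_def G_def by (simp add: case_prod_unfold mem_Times_iff)
  moreover define T2' where "T2' = {(z, f, g). (g, f, z) \<in> T2}"
  have "T2' = (\<lambda>(g, f, z). (z, f, g)) ` T2" by (force simp: T2'_def)
  then have "card T2' = card T2" by (simp only:) (rule card_image, auto simp: inj_on_def)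
  ultimately have c2: "real (card T2') \<ge> (\<delta> ^ s) ^ s * (real (card Z) * real (card (F \<times> G)))"
    by (simp add: F(2) G(2) card_cartesian_product mult_ac)
  have s2: "T2' \<subseteq> Z \<times> (F \<times> G)" by (auto simp: T2'_def T2_def)
  define T3 where "T3 = {(h, f, g). h \<in> {..<s} \<rightarrow>\<^sub>E Z \<and> (f, g) \<in> F \<times> G \<and> (\<forall>i<s. (h i, f, g) \<in> T2')}"
  have c3: "real (card T3) \<ge> ((\<delta> ^ s) ^ s) ^ s * (real (card Z) ^ s * real (card (F \<times> G)))"
    using card_power_fibres[OF Z finite_cartesian_product[OF F(1) G(1)] s2 _ c2, of s] \<delta>
    unfolding T3_def by (simp add: case_prod_unfold mem_Times_iff)
  let ?H = "{(f, g, h). f \<in> {..<s} \<rightarrow>\<^sub>E X \<and> g \<in> {..<s} \<rightarrow>\<^sub>E Y \<and> h \<in> {..<s} \<rightarrow>\<^sub>E Z \<and>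
      (\<forall>a<s. \<forall>b<s. \<forall>j<s. (f a, g b, h j) \<in> T)}"
  have fH: "finite ?H"
    by (rule finite_subset[of _ "({..<s} \<rightarrow>\<^sub>E X) \<times> ({..<s} \<rightarrow>\<^sub>E Y) \<times> ({..<s} \<rightarrow>\<^sub>E Z)"])
      (use X Y Z in \<open>auto intro!: finite_PiE finite_cartesian_product\<close>)
  have sub: "(\<lambda>(h, f, g). (f, g, h)) ` T3 \<subseteq> ?H"
    by (auto simp: T3_def T2'_def T2_def T1'_def T1_def F_def G_def)
  have "inj_on (\<lambda>(h, f, g). (f, g, h)) T3" by (auto simp: inj_on_def)
  then have "card T3 \<le> card ?H" using sub fH by (rule card_inj_on_le)
  moreover have "((\<delta> ^ s) ^ s) ^ s * (real (card Z) ^ s * real (card (F \<times> G)))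
      = \<delta> ^ (s ^ 3) * (real (card X) * real (card Y) * real (card Z)) ^ s"
    by (simp add: F(2) G(2) card_cartesian_product power_mult_distrib power_mult[symmetric] power3_eq_cube mult_ac)
  ultimately show ?thesis using c3 by linarith
qed

lemma card_funcset_two_values:
  assumes "a < s" "a' < s" "a \<noteq> a'" "x \<in> X" "x' \<in> X"
  shows "card {f \<in> {..<s} \<rightarrow>\<^sub>E X. f a = x \<and> f a' = x'} = card X ^ (s - 2)"
proof -
  let ?U = "\<lambda>i. if i = a then {x} else if i = a' then {x'} else X"
  have "{f \<in> {..<s} \<rightarrow>\<^sub>E X. f a = x \<and> f a' = x'} = PiE {..<s} ?U"
  proof (intro set_eqI iffI)
    fix f assume "f \<in> {f \<in> {..<s} \<rightarrow>\<^sub>E X. f a = x \<and> f a' = x'}"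
    then show "f \<in> PiE {..<s} ?U" by (simp add: PiE_iff)
  next
    fix f assume f: "f \<in> PiE {..<s} ?U"
    have "f i \<in> X" if "i < s" for i
      using PiE_mem[OF f, of i] that assms(4,5) by (simp split: if_split_asm)
    moreover have "f a = x" "f a' = x'"
      using PiE_mem[OF f, of a] PiE_mem[OF f, of a'] assms(1-3) by simp_all
    ultimately show "f \<in> {f \<in> {..<s} \<rightarrow>\<^sub>E X. f a = x \<and> f a' = x'}"
      using f by (simp add: PiE_iff)
  qed
  also have "card \<dots> = (\<Prod>i\<in>{..<s}. card (?U i))" by (simp add: card_PiE)
  also have "\<dots> = (\<Prod>i\<in>{..<s} - {a, a'}. card (?U i)) * (\<Prod>i\<in>{a, a'}. card (?U i))"
    by (rule prod.subset_diff) (use assms in auto)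
  also have "(\<Prod>i\<in>{a, a'}. card (?U i)) = 1" using assms by simp
  also have "(\<Prod>i\<in>{..<s} - {a, a'}. card (?U i)) = (\<Prod>i\<in>{..<s} - {a, a'}. card X)"
    by (rule prod.cong) auto
  also have "\<dots> = card X ^ (s - 2)" using assms by (simp add: card_Diff_subset numeral_2_eq_2)
  finally show ?thesis by simp
qed

text \<open>A pair in \<open>R\<close> prescribes two values of each of the three maps and leaves s
  - 2 free ones in each.\<close>

lemma card_conflicting_pairs:
  assumes X: "finite X" and Y: "finite Y" and Z: "finite Z" and R: "R \<subseteq> (X \<times> Y \<times> Z) \<times> (X \<times> Y \<times> Z)"
    and ind: "a < s" "a' < s" "a \<noteq> a'" "b < s" "b' < s" "b \<noteq> b'" "j < s" "j' < s" "j \<noteq> j'"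
  shows "card {(f, g, h). f \<in> {..<s} \<rightarrow>\<^sub>E X \<and> g \<in> {..<s} \<rightarrow>\<^sub>E Y \<and> h \<in> {..<s} \<rightarrow>\<^sub>E Z \<and>
      ((f a, g b, h j), (f a', g b', h j')) \<in> R}
    \<le> card R * (card X * card Y * card Z) ^ (s - 2)"
    (is "card ?B \<le> _")
proof -
  let ?fx = "\<lambda>x x'. {f \<in> {..<s} \<rightarrow>\<^sub>E X. f a = x \<and> f a' = x'}"
  let ?fy = "\<lambda>y y'. {g \<in> {..<s} \<rightarrow>\<^sub>E Y. g b = y \<and> g b' = y'}"
  let ?fz = "\<lambda>z z'. {h \<in> {..<s} \<rightarrow>\<^sub>E Z. h j = z \<and> h j' = z'}"
  define P where "P = (\<lambda>((x, y, z), (x', y', z')). ?fx x x' \<times> ?fy y y' \<times> ?fz z z')"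
  have fR: "finite R" by (rule finite_subset[OF R]) (use X Y Z in \<open>auto intro!: finite_cartesian_product\<close>)
  have finP: "finite (P r)" for r
    using X Y Z by (cases r) (auto simp: P_def intro!: finite_cartesian_product finite_PiE)
  have "?B \<subseteq> (\<Union>r\<in>R. P r)"
  proof
    fix w assume "w \<in> ?B"
    then obtain f g h where w: "w = (f, g, h)" "f \<in> {..<s} \<rightarrow>\<^sub>E X" "g \<in> {..<s} \<rightarrow>\<^sub>E Y" "h \<in> {..<s} \<rightarrow>\<^sub>E Z"
      "((f a, g b, h j), (f a', g b', h j')) \<in> R" by blast
    have "w \<in> P ((f a, g b, h j), (f a', g b', h j'))" using w(1-4) by (simp add: P_def)
    then show "w \<in> (\<Union>r\<in>R. P r)" using w(5) by blast
  qed
  then have "card ?B \<le> card (\<Union>r\<in>R. P r)" using fR finP by (intro card_mono) auto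
  also have "\<dots> \<le> (\<Sum>r\<in>R. card (P r))" by (rule card_UN_le[OF fR])
  also have "\<dots> = (\<Sum>r\<in>R. (card X * card Y * card Z) ^ (s - 2))"
  proof (rule sum.cong[OF refl])
    fix r assume "r \<in> R"
    then obtain x y z x' y' z' where r: "r = ((x, y, z), (x', y', z'))"
      "x \<in> X" "y \<in> Y" "z \<in> Z" "x' \<in> X" "y' \<in> Y" "z' \<in> Z" using R by blast
    show "card (P r) = (card X * card Y * card Z) ^ (s - 2)"
      using card_funcset_two_values[OF ind(1-3) r(2,5)] card_funcset_two_values[OF ind(4-6) r(3,6)]
        card_funcset_two_values[OF ind(7-9) r(4,7)]
      by (simp add: P_def r(1) card_cartesian_product power_mult_distrib)
  qed
  finally show ?thesis by simp
qed

text \<open>First moment argument with N = |X| |Y| |Z|: there are at most s^6 pairs of index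
  triples, each spoils at most |R| N^(s-2) <= \<rho> N^s systems, and at least \<delta>^(s^3) N^s
  systems exist. The bound on \<rho> leaves one unspoilt. Two equal vertices at different indices
  will be among the conflicts, so no injectivity is asked for.\<close>

lemma conflict_free_tripartite:
  fixes \<delta> \<rho> :: real
  assumes X: "finite X" "X \<noteq> {}" and Y: "finite Y" "Y \<noteq> {}" and Z: "finite Z" "Z \<noteq> {}"
    and T: "T \<subseteq> X \<times> Y \<times> Z" and \<delta>: "\<delta> > 0"
    and card: "real (card T) \<ge> \<delta> * (real (card X) * real (card Y) * real (card Z))"
    and R: "R \<subseteq> (X \<times> Y \<times> Z) \<times> (X \<times> Y \<times> Z)"
    and cR: "real (card R) \<le> \<rho> * (real (card X) * real (card Y) * real (card Z)) ^ 2"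
    and \<rho>: "real s ^ 6 * \<rho> < \<delta> ^ (s ^ 3)" and s: "s \<ge> 2"
  obtains f g h where "\<And>a b j. a < s \<Longrightarrow> b < s \<Longrightarrow> j < s \<Longrightarrow> (f a, g b, h j) \<in> T"
    and "\<And>a b j a' b' j'. a < s \<Longrightarrow> b < s \<Longrightarrow> j < s \<Longrightarrow> a' < s \<Longrightarrow> b' < s \<Longrightarrow> j' < s \<Longrightarrow>
       a \<noteq> a' \<Longrightarrow> b \<noteq> b' \<Longrightarrow> j \<noteq> j' \<Longrightarrow> ((f a, g b, h j), (f a', g b', h j')) \<notin> R"
proof -
  let ?N = "real (card X) * real (card Y) * real (card Z)"
  let ?H = "{(f, g, h). f \<in> {..<s} \<rightarrow>\<^sub>E X \<and> g \<in> {..<s} \<rightarrow>\<^sub>E Y \<and> h \<in> {..<s} \<rightarrow>\<^sub>E Z \<and>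
      (\<forall>a<s. \<forall>b<s. \<forall>j<s. (f a, g b, h j) \<in> T)}"
  define B where "B = (\<lambda>(a, b, j, a', b', j'). {(f, g, h). f \<in> {..<s} \<rightarrow>\<^sub>E X \<and> g \<in> {..<s} \<rightarrow>\<^sub>E Y \<and>
      h \<in> {..<s} \<rightarrow>\<^sub>E Z \<and> ((f a, g b, h j), (f a', g b', h j')) \<in> R})"
  let ?J = "{..<s} \<times> {..<s} \<times> {..<s} \<times> {..<s} \<times> {..<s} \<times> {..<s}"
  define I where "I = {(a, b, j, a', b', j') \<in> ?J. a \<noteq> a' \<and> b \<noteq> b' \<and> j \<noteq> j'}"
  have N: "?N > 0" using X Y Z by (simp add: card_gt_0_iff)
  have fJ: "finite ?J" by simp
  have IJ: "I \<subseteq> ?J" by (auto simp: I_def)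
  then have fI: "finite I" using fJ by (rule finite_subset)
  have "card I \<le> card ?J" by (rule card_mono[OF fJ IJ])
  also have "\<dots> = s ^ 6" by (simp add: card_cartesian_product eval_nat_numeral)
  finally have cI: "card I \<le> s ^ 6" .
  have fB: "finite (B i)" for i
    by (rule finite_subset[of _ "({..<s} \<rightarrow>\<^sub>E X) \<times> ({..<s} \<rightarrow>\<^sub>E Y) \<times> ({..<s} \<rightarrow>\<^sub>E Z)"])
      (use X Y Z in \<open>auto simp: B_def intro!: finite_PiE finite_cartesian_product\<close>)
  have "card (\<Union>i\<in>I. B i) \<le> (\<Sum>i\<in>I. card (B i))" by (rule card_UN_le[OF fI])
  also have "\<dots> \<le> (\<Sum>i\<in>I. card R * (card X * card Y * card Z) ^ (s - 2))"
  proof (rule sum_mono)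
    fix i assume "i \<in> I"
    then obtain a b j a' b' j' where i: "i = (a, b, j, a', b', j')"
      "a < s" "a' < s" "a \<noteq> a'" "b < s" "b' < s" "b \<noteq> b'" "j < s" "j' < s" "j \<noteq> j'"
      by (auto simp: I_def)
    show "card (B i) \<le> card R * (card X * card Y * card Z) ^ (s - 2)"
      using card_conflicting_pairs[OF X(1) Y(1) Z(1) R i(2-10)] by (simp add: B_def i(1))
  qed
  also have "\<dots> \<le> s ^ 6 * (card R * (card X * card Y * card Z) ^ (s - 2))"
    using cI by simp
  finally have "real (card (\<Union>i\<in>I. B i)) \<le> real (s ^ 6 * (card R * (card X * card Y * card Z) ^ (s - 2)))"
    by (rule of_nat_mono)
  also have "\<dots> = real s ^ 6 * (real (card R) * ?N ^ (s - 2))" by simp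
  also have "\<dots> \<le> real s ^ 6 * (\<rho> * ?N ^ 2 * ?N ^ (s - 2))"
    using cR N by (intro mult_left_mono mult_right_mono) auto
  also have "\<dots> = real s ^ 6 * \<rho> * ?N ^ s"
  proof -
    have "?N ^ s = ?N ^ 2 * ?N ^ (s - 2)" using s by (metis le_add_diff_inverse power_add)
    then show ?thesis by (simp only: mult.assoc)
  qed
  also have "\<dots> < \<delta> ^ (s ^ 3) * ?N ^ s"
    using \<rho> N by (intro mult_strict_right_mono) auto
  also have "\<dots> \<le> real (card ?H)"
    by (rule card_homs_complete_tripartite[OF X(1) Y(1) Z(1) T \<delta> card])
  finally have "card (\<Union>i\<in>I. B i) < card ?H" by simp
  moreover define H where "H = ?H"
  moreover have "finite (\<Union>i\<in>I. B i)" using fI fB by (rule finite_UN_I)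
  ultimately have "\<not> H \<subseteq> (\<Union>i\<in>I. B i)" using card_mono leD by metis
  then obtain w where w: "w \<in> H" "w \<notin> (\<Union>i\<in>I. B i)" by blast
  from w(1)[unfolded H_def] obtain f g h where fgh: "w = (f, g, h)" "f \<in> {..<s} \<rightarrow>\<^sub>E X" "g \<in> {..<s} \<rightarrow>\<^sub>E Y" "h \<in> {..<s} \<rightarrow>\<^sub>E Z"
    "\<forall>a<s. \<forall>b<s. \<forall>j<s. (f a, g b, h j) \<in> T" by (elim CollectE case_prodE) simp
  show ?thesis
  proof
    show "(f a, g b, h j) \<in> T" if "a < s" "b < s" "j < s" for a b j using fgh(5) that by blast
    show "((f a, g b, h j), (f a', g b', h j')) \<notin> R"
      if "a < s" "b < s" "j < s" "a' < s" "b' < s" "j' < s" "a \<noteq> a'" "b \<noteq> b'" "j \<noteq> j'" for a b j a' b' j'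
    proof
      assume "((f a, g b, h j), (f a', g b', h j')) \<in> R"
      then have "w \<in> B (a, b, j, a', b', j')" using fgh by (simp add: B_def)
      moreover have "(a, b, j, a', b', j') \<in> I" using that by (simp add: I_def)
      ultimately show False using w(2) by blast
    qed
  qed
qed

section \<open>Dense systems of coloured faces\<close>

text \<open>Double counting of pairs (vertex, q-set), here through the absorption identity for
  binomials; equality holds for v in V.\<close>

lemma card_subsets_through:
  assumes V: "finite V"
  shows "card V * card {Z. Z \<subseteq> V \<and> card Z = q \<and> v \<in> Z} \<le> q * card {Z. Z \<subseteq> V \<and> card Z = q}"
proof (cases "v \<in> V")
  case False
  then have "{Z. Z \<subseteq> V \<and> card Z = q \<and> v \<in> Z} = {}" by auto
  then show ?thesis by (simp only: card.empty)
next
  case v: True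
  show ?thesis
  proof (cases q)
    case 0
    then have "{Z. Z \<subseteq> V \<and> card Z = q \<and> v \<in> Z} = {}"
      using finite_subset[OF _ V] by auto
    then show ?thesis by (simp only: card.empty)
  next
    case (Suc p)
    obtain m where m: "card V = Suc m" using v V by (metis card_Suc_Diff1)
    have "card {Z. Z \<subseteq> V \<and> card Z = q \<and> v \<in> Z} \<le> card {Z. Z \<subseteq> V - {v} \<and> card Z = p}"
    proof (rule card_inj_on_le)
      show "inj_on (\<lambda>Z. Z - {v}) {Z. Z \<subseteq> V \<and> card Z = q \<and> v \<in> Z}"
        by (intro inj_onI) (metis (no_types, lifting) insert_Diff mem_Collect_eq)
      show "(\<lambda>Z. Z - {v}) ` {Z. Z \<subseteq> V \<and> card Z = q \<and> v \<in> Z} \<subseteq> {Z. Z \<subseteq> V - {v} \<and> card Z = p}"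
        using Suc finite_subset[OF _ V] by auto
      show "finite {Z. Z \<subseteq> V - {v} \<and> card Z = p}" using V by simp
    qed
    also have "\<dots> = m choose p" using n_subsets[of "V - {v}" p] V v m by simp
    finally have "card V * card {Z. Z \<subseteq> V \<and> card Z = q \<and> v \<in> Z} \<le> Suc m * (m choose p)"
      unfolding m by (rule mult_le_mono2)
    also have "\<dots> = q * (Suc m choose q)" using Suc_times_binomial[of p m] Suc by simp
    also have "\<dots> = q * card {Z. Z \<subseteq> V \<and> card Z = q}" using n_subsets[OF V, of q] m by simp
    finally show ?thesis .
  qed
qed

fun triple_set :: "'v \<times> 'v \<times> 'v set \<Rightarrow> 'v set" where
  "triple_set (x, y, Z) = insert x (insert y Z)"

text \<open>Degenerate triples with repeated vertices are included, so that this is a genuine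
  product to which the tripartite count applies. \<open>admissible_edge\<close> rules them out for
  the system \<open>T\<close> itself.\<close>

definition triples :: "nat \<Rightarrow> 'v set \<Rightarrow> ('v \<times> 'v \<times> 'v set) set" where
  "triples q V = V \<times> V \<times> {Z. Z \<subseteq> V \<and> card Z = q}"

lemma finite_triples: "finite V \<Longrightarrow> finite (triples q V)"
  by (simp add: triples_def)

lemma card_triples: "finite V \<Longrightarrow> card (triples q V) = card V * card V * (card V choose q)"
  by (simp add: triples_def card_cartesian_product n_subsets)

lemma card_triples_through:
  assumes V: "finite V"
  shows "card V * card {u \<in> triples q V. v \<in> triple_set u} \<le> (q + 2) * card (triples q V)"
proof -
  let ?Z = "{Z. Z \<subseteq> V \<and> card Z = q}"
  let ?Zv = "{Z. Z \<subseteq> V \<and> card Z = q \<and> v \<in> Z}"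
  let ?n = "card V"
  have fin: "finite ?Z" "finite ?Zv" using V by simp_all
  have "{u \<in> triples q V. v \<in> triple_set u}
      \<subseteq> ({v} \<times> V \<times> ?Z) \<union> (V \<times> {v} \<times> ?Z) \<union> (V \<times> V \<times> ?Zv)"
    by (auto simp: triples_def)
  then have "card {u \<in> triples q V. v \<in> triple_set u}
      \<le> card (({v} \<times> V \<times> ?Z) \<union> (V \<times> {v} \<times> ?Z) \<union> (V \<times> V \<times> ?Zv))"
    using V fin by (intro card_mono) auto
  also have "\<dots> \<le> card ({v} \<times> V \<times> ?Z) + card (V \<times> {v} \<times> ?Z) + card (V \<times> V \<times> ?Zv)"
    by (meson add_mono card_Un_le le_refl order_trans)
  also have "\<dots> = ?n * card ?Z + ?n * card ?Z + ?n * (?n * card ?Zv)"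
    by (simp only: card_cartesian_product) simp
  finally have "?n * card {u \<in> triples q V. v \<in> triple_set u}
      \<le> ?n * (?n * card ?Z + ?n * card ?Z + ?n * (?n * card ?Zv))" by (rule mult_le_mono2)
  also have "\<dots> = 2 * (?n * ?n * card ?Z) + ?n * ?n * (?n * card ?Zv)" by (simp add: algebra_simps)
  also have "\<dots> \<le> 2 * (?n * ?n * card ?Z) + ?n * ?n * (q * card ?Z)"
    by (intro add_left_mono mult_le_mono2 card_subsets_through[OF V])
  also have "\<dots> = (q + 2) * card (triples q V)"
    unfolding triples_def by (simp add: card_cartesian_product algebra_simps)
  finally show ?thesis .
qed

text \<open>The two terms are the two ways to conflict with a fixed u. At most q + 2 + t vertices
  lie in its face or list, each contained in a fraction (q + 2) / |V| of all triples; and at most t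
  light colours occur in its list, each also occurring in the lists of a fraction \<eta>.\<close>

lemma card_conflicts:
  fixes \<eta> :: real
  assumes V: "finite V" "V \<noteq> {}" and T: "T \<subseteq> triples q V"
    and adm: "\<And>x y Z. (x, y, Z) \<in> T \<Longrightarrow> admissible_edge t q L C x y Z"
    and light: "\<And>v. v \<notin> C \<Longrightarrow> real (card {u \<in> T. v \<in> L (triple_set u)}) \<le> \<eta> * real (card (triples q V))"
    and t: "t > 0" and \<eta>: "\<eta> \<ge> 0"
  shows "real (card {(u, u'). u \<in> T \<and> u' \<in> T \<and> \<not> conflict_free L C (triple_set u) (triple_set u')})
    \<le> (real ((q + 2 + t) * (q + 2)) / real (card V) + real t * \<eta>) * real (card (triples q V)) ^ 2"
    (is "real (card ?R) \<le> ?\<rho> * ?N ^ 2")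
proof -
  have fU: "finite (triples q V)" using finite_triples[OF V(1)] .
  have fT: "finite T" using finite_subset[OF T fU] .
  have n: "real (card V) > 0" using V by (simp add: card_gt_0_iff)
  define W where "W = (\<lambda>u. triple_set u \<union> L (triple_set u))"
  define Q where "Q = (\<lambda>u. (\<Union>v\<in>W u. {u' \<in> triples q V. v \<in> triple_set u'}) \<union>
      (\<Union>v\<in>L (triple_set u) - C. {u' \<in> T. v \<in> L (triple_set u')}))"
  have fQ: "finite (Q u)" for u
    by (rule finite_subset[OF _ fU]) (use T in \<open>auto simp: Q_def\<close>)
  have "?R \<subseteq> (SIGMA u:T. Q u)"
  proof
    fix r assume "r \<in> ?R"
    then obtain u u' where r: "r = (u, u')" "u \<in> T" "u' \<in> T" "\<not> conflict_free L C (triple_set u) (triple_set u')"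
      by blast
    then have "W u \<inter> triple_set u' \<noteq> {} \<or> (L (triple_set u) - C) \<inter> L (triple_set u') \<noteq> {}"
      unfolding conflict_free_def W_def by blast
    then have "u' \<in> Q u" using r(3) T unfolding Q_def by blast
    then show "r \<in> (SIGMA u:T. Q u)" using r by simp
  qed
  then have "card ?R \<le> card (SIGMA u:T. Q u)" using fT fQ by (intro card_mono) auto
  also have "\<dots> = (\<Sum>u\<in>T. card (Q u))" using fT fQ by (intro card_SigmaI) auto
  finally have "real (card ?R) \<le> real (\<Sum>u\<in>T. card (Q u))" by (rule of_nat_mono)
  also have "\<dots> = (\<Sum>u\<in>T. real (card (Q u)))" by simp
  also have "\<dots> \<le> (\<Sum>u\<in>T. ?\<rho> * ?N)"
  proof (rule sum_mono)
    fix u assume u: "u \<in> T"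
    obtain x y Z where xyZ: "u = (x, y, Z)" by (cases u)
    have a: "finite Z" "card Z = q" "card (L (triple_set u)) = t" "x \<noteq> y" "x \<notin> Z" "y \<notin> Z"
      using adm[of x y Z] u by (auto simp: admissible_edge_def xyZ)
    have fL: "finite (L (triple_set u))" using a(3) t by (intro card_ge_0_finite) simp
    have "card (triple_set u) = q + 2" using a by (simp add: xyZ)
    then have fW: "finite (W u)" "card (W u) \<le> q + 2 + t"
      using a(1,3) fL card_Un_le[of "triple_set u" "L (triple_set u)"] by (simp_all add: W_def xyZ)
    have one: "real (card {u' \<in> triples q V. v \<in> triple_set u'}) \<le> real (q + 2) / real (card V) * ?N" for v
    proof -
      have "real (card V) * real (card {u' \<in> triples q V. v \<in> triple_set u'}) \<le> real (q + 2) * ?N"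
        using of_nat_mono[OF card_triples_through[OF V(1), of q v], where 'a = real]
        by (simp add: distrib_right)
      then show ?thesis using n by (simp add: field_simps)
    qed
    have "card (Q u) \<le> card (\<Union>v\<in>W u. {u' \<in> triples q V. v \<in> triple_set u'})
        + card (\<Union>v\<in>L (triple_set u) - C. {u' \<in> T. v \<in> L (triple_set u')})"
      unfolding Q_def by (rule card_Un_le)
    also have "\<dots> \<le> (\<Sum>v\<in>W u. card {u' \<in> triples q V. v \<in> triple_set u'})
        + (\<Sum>v\<in>L (triple_set u) - C. card {u' \<in> T. v \<in> L (triple_set u')})"
      using fW fL by (intro add_mono card_UN_le) auto
    finally have "real (card (Q u)) \<le> real ((\<Sum>v\<in>W u. card {u' \<in> triples q V. v \<in> triple_set u'})
        + (\<Sum>v\<in>L (triple_set u) - C. card {u' \<in> T. v \<in> L (triple_set u')}))"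
      by (rule of_nat_mono)
    also have "\<dots> = (\<Sum>v\<in>W u. real (card {u' \<in> triples q V. v \<in> triple_set u'}))
        + (\<Sum>v\<in>L (triple_set u) - C. real (card {u' \<in> T. v \<in> L (triple_set u')}))" by simp
    also have "\<dots> \<le> (\<Sum>v\<in>W u. real (q + 2) / real (card V) * ?N)
        + (\<Sum>v\<in>L (triple_set u) - C. \<eta> * ?N)"
      using one light by (intro add_mono sum_mono) auto
    also have "\<dots> = real (card (W u)) * (real (q + 2) / real (card V) * ?N)
        + real (card (L (triple_set u) - C)) * (\<eta> * ?N)" by simp
    also have "\<dots> \<le> real (q + 2 + t) * (real (q + 2) / real (card V) * ?N) + real t * (\<eta> * ?N)"
    proof (intro add_mono mult_right_mono)
      show "real (card (W u)) \<le> real (q + 2 + t)" using fW(2) by (rule of_nat_mono)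
      have "card (L (triple_set u) - C) \<le> t" using card_mono[OF fL, of "L (triple_set u) - C"] a(3) by auto
      then show "real (card (L (triple_set u) - C)) \<le> real t" by (rule of_nat_mono)
    qed (use \<eta> in auto)
    also have "\<dots> = ?\<rho> * ?N" by (simp add: algebra_simps)
    finally show "real (card (Q u)) \<le> ?\<rho> * ?N" .
  qed
  also have "\<dots> = real (card T) * (?\<rho> * ?N)" by simp
  also have "\<dots> \<le> ?N * (?\<rho> * ?N)"
    using card_mono[OF fU T] \<eta> by (intro mult_right_mono) auto
  finally show ?thesis by (simp add: power2_eq_square mult_ac)
qed

lemma light_system_cycle:
  fixes \<delta> \<eta> :: real
  assumes V: "finite V" "card V \<ge> q" "V \<noteq> {}" and T: "T \<subseteq> triples q V" and t: "t \<ge> 2"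
    and adm: "\<And>x y Z. (x, y, Z) \<in> T \<Longrightarrow> admissible_edge t q L C x y Z"
    and light: "\<And>v. v \<notin> C \<Longrightarrow> real (card {u \<in> T. v \<in> L (triple_set u)}) \<le> \<eta> * real (card (triples q V))"
    and \<delta>: "\<delta> > 0" "real (card T) \<ge> \<delta> * real (card (triples q V))" and \<eta>: "\<eta> \<ge> 0"
    and small: "real (3 * t) ^ 6 * (real ((q + 2 + t) * (q + 2)) / real (card V) + real t * \<eta>) < \<delta> ^ ((3 * t) ^ 3)"
  shows "\<exists>g. linear_cycle_family (q + 3) (2 * t) g \<and>
    (\<forall>i<2 * t. \<exists>u\<in>T. \<exists>v\<in>L (triple_set u). g i = insert v (triple_set u))"
proof -
  let ?Z = "{Z. Z \<subseteq> V \<and> card Z = q}"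
  let ?R = "{(u, u'). u \<in> T \<and> u' \<in> T \<and> \<not> conflict_free L C (triple_set u) (triple_set u')}"
  have N: "real (card (triples q V)) = real (card V) * real (card V) * real (card ?Z)"
    unfolding triples_def by (simp add: card_cartesian_product)
  have Z: "finite ?Z" "?Z \<noteq> {}" using V obtain_subset_with_card_n[of q V] by auto
  have T': "T \<subseteq> V \<times> V \<times> ?Z" using T by (simp add: triples_def)
  have R: "?R \<subseteq> (V \<times> V \<times> ?Z) \<times> (V \<times> V \<times> ?Z)" using T' by blast
  have cR: "real (card ?R) \<le> (real ((q + 2 + t) * (q + 2)) / real (card V) + real t * \<eta>) *
      (real (card V) * real (card V) * real (card ?Z)) ^ 2"
    unfolding N[symmetric] by (rule card_conflicts[OF V(1,3) T adm light _ \<eta>]) (use t in auto)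
  have s: "3 * t \<ge> 2" using t by simp
  obtain f g h where fgh: "\<And>a b j. a < 3 * t \<Longrightarrow> b < 3 * t \<Longrightarrow> j < 3 * t \<Longrightarrow> (f a, g b, h j) \<in> T"
    and nR: "\<And>a b j a' b' j'. a < 3 * t \<Longrightarrow> b < 3 * t \<Longrightarrow> j < 3 * t \<Longrightarrow> a' < 3 * t \<Longrightarrow> b' < 3 * t \<Longrightarrow> j' < 3 * t \<Longrightarrow>
       a \<noteq> a' \<Longrightarrow> b \<noteq> b' \<Longrightarrow> j \<noteq> j' \<Longrightarrow> ((f a, g b, h j), (f a', g b', h j')) \<notin> ?R"
    using conflict_free_tripartite[OF V(1,3) V(1,3) Z T' \<delta>(1) \<delta>(2)[unfolded N] R cR small s] by blast
  have "configuration (3 * t) t q L C f g h"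
    unfolding configuration_def
  proof (intro conjI allI impI)
    fix a b j a' b' j' assume lt: "a < 3 * t" "b < 3 * t" "j < 3 * t" "a' < 3 * t" "b' < 3 * t" "j' < 3 * t"
      and ne: "a \<noteq> a'" "b \<noteq> b'" "j \<noteq> j'"
    show "conflict_free L C (insert (f a) (insert (g b) (h j))) (insert (f a') (insert (g b') (h j')))"
      using nR[OF lt ne] fgh[OF lt(1-3)] fgh[OF lt(4-6)] by simp
  qed (intro adm fgh)
  from configuration_cycle[OF this t order_refl]
  obtain c where c: "linear_cycle_family (q + 3) (2 * t) c"
    "\<And>i. i < 2 * t \<Longrightarrow> \<exists>a<3 * t. \<exists>b<3 * t. \<exists>j<3 * t. \<exists>v\<in>L (insert (f a) (insert (g b) (h j))).
       c i = insert v (insert (f a) (insert (g b) (h j)))" by blast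
  have "\<exists>u\<in>T. \<exists>v\<in>L (triple_set u). c i = insert v (triple_set u)" if i: "i < 2 * t" for i
  proof -
    obtain a b j v where "a < 3 * t" "b < 3 * t" "j < 3 * t" "v \<in> L (insert (f a) (insert (g b) (h j)))"
      "c i = insert v (insert (f a) (insert (g b) (h j)))" using c(2)[OF i] by blast
    then show ?thesis using fgh[of a b j] by (intro bexI[of _ "(f a, g b, h j)"] bexI[of _ v]) simp_all
  qed
  then show ?thesis using c(1) by blast
qed

text \<open>If some vertex outside \<open>C\<close> is a colour of a positive fraction of \<open>T\<close>, pass to those faces and add the
  vertex to \<open>C\<close>, which has at most \<open>t\<close> elements; otherwise conflicts are rare. Looking at one heavy vertex at
  a time keeps \<open>\<eta>\<close> a function of \<open>\<delta>\<close> alone.\<close>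

lemma dense_system_cycle:
  fixes \<delta> :: real
  assumes t: "t \<ge> 2"
  shows "c \<le> t \<Longrightarrow> \<delta> > 0 \<Longrightarrow> \<exists>n0. \<forall>(V :: 'v set) L C T. finite V \<longrightarrow> n0 \<le> card V \<longrightarrow> T \<subseteq> triples q V \<longrightarrow>
     \<delta> * real (card (triples q V)) \<le> real (card T) \<longrightarrow> finite C \<longrightarrow> card C = c \<longrightarrow>
     (\<forall>x y Z. (x, y, Z) \<in> T \<longrightarrow> admissible_edge t q L C x y Z) \<longrightarrow>
     (\<exists>g. linear_cycle_family (q + 3) (2 * t) g \<and>
        (\<forall>i<2 * t. \<exists>u\<in>T. \<exists>v\<in>L (triple_set u). g i = insert v (triple_set u)))"
proof (induction "t - c" arbitrary: c \<delta> rule: less_induct)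
  case less
  define \<kappa> where "\<kappa> = \<delta> ^ ((3 * t) ^ 3)"
  define s6 where "s6 = real (3 * t) ^ 6"
  define K where "K = real ((q + 2 + t) * (q + 2))"
  \<comment> \<open>This gives the conflicts through light colours one quarter of the permitted
    amount \<kappa>; \<open>n2\<close> will make |V| large enough for the coinciding vertices to
    take less than another quarter.\<close>
  define \<eta> where "\<eta> = \<kappa> / (4 * real t * s6)"
  have pos: "\<kappa> > 0" "s6 > 0" "real t > 0" "K > 0" using less.prems t by (auto simp: \<kappa>_def s6_def K_def simp del: of_nat_mult of_nat_add)
  then have \<eta>: "\<eta> > 0" by (simp add: \<eta>_def)
  \<comment> \<open>This is the induction hypothesis for c + 1 with \<open>c < t\<close> moved
    inside, so that it holds vacuously for c = t and one \<open>n1\<close> serves both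
    cases.\<close>
  have "\<exists>n1. \<forall>(V :: 'v set) L C T. finite V \<longrightarrow> n1 \<le> card V \<longrightarrow> T \<subseteq> triples q V \<longrightarrow>
     \<eta> * real (card (triples q V)) \<le> real (card T) \<longrightarrow> finite C \<longrightarrow> card C = Suc c \<longrightarrow> c < t \<longrightarrow>
     (\<forall>x y Z. (x, y, Z) \<in> T \<longrightarrow> admissible_edge t q L C x y Z) \<longrightarrow>
     (\<exists>g. linear_cycle_family (q + 3) (2 * t) g \<and>
        (\<forall>i<2 * t. \<exists>u\<in>T. \<exists>v\<in>L (triple_set u). g i = insert v (triple_set u)))"
  proof (cases "c < t")
    case True
    then have "t - Suc c < t - c" "Suc c \<le> t" by auto
    from less.hyps[OF this \<eta>] show ?thesis using True by simp
  qed simp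
  then obtain n1 where n1: "\<forall>(V :: 'v set) L C T. finite V \<longrightarrow> n1 \<le> card V \<longrightarrow> T \<subseteq> triples q V \<longrightarrow>
     \<eta> * real (card (triples q V)) \<le> real (card T) \<longrightarrow> finite C \<longrightarrow> card C = Suc c \<longrightarrow> c < t \<longrightarrow>
     (\<forall>x y Z. (x, y, Z) \<in> T \<longrightarrow> admissible_edge t q L C x y Z) \<longrightarrow>
     (\<exists>g. linear_cycle_family (q + 3) (2 * t) g \<and>
        (\<forall>i<2 * t. \<exists>u\<in>T. \<exists>v\<in>L (triple_set u). g i = insert v (triple_set u)))" ..
  define n2 where "n2 = nat \<lceil>4 * K * s6 / \<kappa>\<rceil> + 1"
  show ?case
  proof (intro exI[of _ "n1 + n2 + q"] allI impI)
    fix V :: "'v set" and L C T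
    assume V: "finite V" "n1 + n2 + q \<le> card V" and T: "T \<subseteq> triples q V"
      and cT: "\<delta> * real (card (triples q V)) \<le> real (card T)" and C: "finite C" "card C = c"
      and adm: "\<forall>x y Z. (x, y, Z) \<in> T \<longrightarrow> admissible_edge t q L C x y Z"
    have V': "V \<noteq> {}" "card V \<ge> q" using V(2) by (auto simp: n2_def)
    have fT: "finite T" using T finite_triples[OF V(1)] by (rule finite_subset)
    have "real n2 \<le> real (card V)" using V(2) by simp
    then have n: "4 * K * s6 / \<kappa> < real (card V)" unfolding n2_def by linarith
    have n0: "real (card V) > 0" using V V' by (simp add: card_gt_0_iff)
    let ?concl = "\<exists>g. linear_cycle_family (q + 3) (2 * t) g \<and>
        (\<forall>i<2 * t. \<exists>u\<in>T. \<exists>v\<in>L (triple_set u). g i = insert v (triple_set u))"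
    show ?concl
    proof (cases "\<forall>v. v \<notin> C \<longrightarrow> real (card {u \<in> T. v \<in> L (triple_set u)}) \<le> \<eta> * real (card (triples q V))")
      case True
      have "s6 * (K / real (card V)) < \<kappa> / 4"
        using n pos n0 by (simp add: field_simps)
      moreover have "s6 * (real t * \<eta>) = \<kappa> / 4" using pos by (simp add: \<eta>_def)
      ultimately have "s6 * (K / real (card V) + real t * \<eta>) < \<kappa>"
        unfolding distrib_left using pos(1) by linarith
      then show ?thesis
        using light_system_cycle[OF V(1) V'(2,1) T t _ _ less.prems(2) cT, of L C \<eta>] adm True \<eta>
        by (simp add: s6_def K_def \<kappa>_def)
    next
      case False
      then obtain v where v: "v \<notin> C" "real (card {u \<in> T. v \<in> L (triple_set u)}) > \<eta> * real (card (triples q V))"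
        by (auto simp: not_le)
      define T' where "T' = {u \<in> T. v \<in> L (triple_set u)}"
      have "0 \<le> \<eta> * real (card (triples q V))" using \<eta> by simp
      then have "card T' \<noteq> 0" using v(2) by (auto simp: T'_def)
      then have "T' \<noteq> {}" by auto
      then obtain x y Z where xyZ: "(x, y, Z) \<in> T'" by auto
      then have a: "C \<subseteq> L (insert x (insert y Z))" "card (L (insert x (insert y Z))) = t" "v \<in> L (insert x (insert y Z))"
        using adm by (auto simp: T'_def admissible_edge_def)
      then have "finite (L (insert x (insert y Z)))" using t by (intro card_ge_0_finite) simp
      then have "card (insert v C) \<le> t" using a card_mono[of "L (insert x (insert y Z))" "insert v C"] by simp
      then have ct: "c < t" "card (insert v C) = Suc c" using C v(1) by auto
      have "\<exists>g. linear_cycle_family (q + 3) (2 * t) g \<and>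
        (\<forall>i<2 * t. \<exists>u\<in>T'. \<exists>v\<in>L (triple_set u). g i = insert v (triple_set u))"
      proof (rule n1[THEN spec, of V, THEN spec, of L, THEN spec, of "insert v C", THEN spec, of T',
            THEN mp, THEN mp, THEN mp, THEN mp, THEN mp, THEN mp, THEN mp, THEN mp])
        show "card (insert v C) = Suc c" "c < t" by (rule ct)+
        show "\<forall>x y Z. (x, y, Z) \<in> T' \<longrightarrow> admissible_edge t q L (insert v C) x y Z"
          using adm by (auto simp: T'_def admissible_edge_def)
      qed (use V T v C in \<open>auto simp: T'_def\<close>)
      moreover have "T' \<subseteq> T" by (auto simp: T'_def)
      ultimately show ?thesis by (meson subsetD)
    qed
  qed
qed

section \<open>Edges of complexes without a linear cycle\<close>

definition down_closed :: "'a set set \<Rightarrow> bool" where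
  "down_closed E \<longleftrightarrow> (\<forall>e\<in>E. \<forall>e'. e' \<subseteq> e \<longrightarrow> e' \<in> E)"

definition nbrs :: "'a set set \<Rightarrow> 'a set \<Rightarrow> 'a set" where
  "nbrs E A = {v. v \<notin> A \<and> insert v A \<in> E}"

definition has_linear_cycle :: "nat \<Rightarrow> nat \<Rightarrow> 'a set set \<Rightarrow> bool" where
  "has_linear_cycle k m E \<longleftrightarrow> (\<exists>g. linear_cycle_family k m g \<and> (\<forall>i<m. g i \<in> E))"

lemma has_linear_cycle_mono: "has_linear_cycle k m E \<Longrightarrow> E \<subseteq> E' \<Longrightarrow> has_linear_cycle k m E'"
  unfolding has_linear_cycle_def by blast

lemma down_closedD: "down_closed E \<Longrightarrow> e \<in> E \<Longrightarrow> e' \<subseteq> e \<Longrightarrow> e' \<in> E"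
  by (simp add: down_closed_def)

lemma nbrs_subset: "E \<subseteq> Pow V \<Longrightarrow> nbrs E A \<subseteq> V"
  by (auto simp: nbrs_def)

text \<open>By down-closure each vertex of \<open>e - A\<close> extends \<open>A\<close> on its own,
  so \<open>e\<close> is \<open>A\<close> together with a set of its neighbours.\<close>

lemma card_supersets_le:
  assumes V: "finite V" "E \<subseteq> Pow V" and E: "down_closed E"
  shows "card {e \<in> E. A \<subseteq> e} \<le> 2 ^ card (nbrs E A)"
proof -
  have fN: "finite (nbrs E A)" using nbrs_subset[OF V(2)] V(1) by (rule finite_subset)
  have "{e \<in> E. A \<subseteq> e} \<subseteq> (\<lambda>B. A \<union> B) ` Pow (nbrs E A)"
  proof
    fix e assume "e \<in> {e \<in> E. A \<subseteq> e}"
    then have e: "e \<in> E" "A \<subseteq> e" by auto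
    have "e - A \<in> Pow (nbrs E A)"
      using down_closedD[OF E e(1)] e(2) by (auto simp: nbrs_def)
    moreover have "e = A \<union> (e - A)" using e(2) by blast
    ultimately show "e \<in> (\<lambda>B. A \<union> B) ` Pow (nbrs E A)" by (rule rev_image_eqI)
  qed
  then have "card {e \<in> E. A \<subseteq> e} \<le> card (Pow (nbrs E A))"
    using fN by (intro surj_card_le) auto
  then show ?thesis using fN by (simp add: card_Pow)
qed

text \<open>Deleting a face \<open>A\<close> with at most \<open>d\<close> extensions destroys at most \<open>2 ^ d\<close> edges. With \<open>d = t - 1\<close> this is the
  source of the main term.\<close>

lemma delete_poor_faces:
  assumes V: "finite V"
  shows "E \<subseteq> Pow V \<Longrightarrow> down_closed E \<Longrightarrow> \<exists>E'\<subseteq>E. down_closed E' \<and>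
    (\<forall>A\<in>E'. card A = w \<longrightarrow> d < card (nbrs E' A)) \<and>
    card {e \<in> E. w \<le> card e} + 2 ^ d * card {A \<in> E'. card A = w}
      \<le> 2 ^ d * card {A \<in> E. card A = w} + card {e \<in> E'. w \<le> card e}"
proof (induction "card E" arbitrary: E rule: less_induct)
  case less
  have fE: "finite E" using less.prems(1) V by (meson finite_Pow_iff finite_subset)
  show ?case
  proof (cases "\<forall>A\<in>E. card A = w \<longrightarrow> d < card (nbrs E A)")
    case True
    then show ?thesis using less.prems(2) by (intro exI[of _ E]) auto
  next
    case False
    then obtain A where A: "A \<in> E" "card A = w" "card (nbrs E A) \<le> d" by (auto simp: not_less)
    define E1 where "E1 = {e \<in> E. \<not> A \<subseteq> e}"
    have sub: "E1 \<subseteq> E" by (auto simp: E1_def)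
    have "E1 \<subset> E" using A(1) by (auto simp: E1_def)
    then have "card E1 < card E" using fE by (intro psubset_card_mono)
    moreover have "E1 \<subseteq> Pow V" using sub less.prems(1) by blast
    moreover have "down_closed E1" using less.prems(2) by (auto simp: down_closed_def E1_def)
    ultimately obtain E' where E': "E' \<subseteq> E1" "down_closed E'" "\<forall>A\<in>E'. card A = w \<longrightarrow> d < card (nbrs E' A)"
      "card {e \<in> E1. w \<le> card e} + 2 ^ d * card {A \<in> E'. card A = w}
      \<le> 2 ^ d * card {A \<in> E1. card A = w} + card {e \<in> E'. w \<le> card e}"
      using less.hyps by meson
    have "{e \<in> E. w \<le> card e} \<subseteq> {e \<in> E1. w \<le> card e} \<union> {e \<in> E. A \<subseteq> e}" by (auto simp: E1_def)
    then have "card {e \<in> E. w \<le> card e} \<le> card ({e \<in> E1. w \<le> card e} \<union> {e \<in> E. A \<subseteq> e})"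
      using fE sub by (intro card_mono) (auto intro: finite_subset)
    also have "\<dots> \<le> card {e \<in> E1. w \<le> card e} + card {e \<in> E. A \<subseteq> e}" by (rule card_Un_le)
    also have "card {e \<in> E. A \<subseteq> e} \<le> 2 ^ card (nbrs E A)"
      by (rule card_supersets_le[OF V less.prems])
    also have "(2::nat) ^ card (nbrs E A) \<le> 2 ^ d" using A(3) by simp
    finally have 1: "card {e \<in> E. w \<le> card e} \<le> card {e \<in> E1. w \<le> card e} + 2 ^ d" by simp
    \<comment> \<open>At least the face \<open>A\<close> itself is lost, and its weight 2^d pays for
      the edges deleted above it.\<close>
    have "{A \<in> E1. card A = w} \<subset> {A \<in> E. card A = w}" using A(1,2) by (auto simp: E1_def)
    then have "card {A \<in> E1. card A = w} < card {A \<in> E. card A = w}"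
      using fE by (intro psubset_card_mono) auto
    then have "2 ^ d * (card {A \<in> E1. card A = w} + 1) \<le> 2 ^ d * card {A \<in> E. card A = w}"
      by (intro mult_le_mono2) simp
    then have "card {e \<in> E. w \<le> card e} + 2 ^ d * card {A \<in> E'. card A = w}
      \<le> 2 ^ d * card {A \<in> E. card A = w} + card {e \<in> E'. w \<le> card e}"
      using 1 E'(4) by simp
    then show ?thesis using E'(1-3) sub by blast
  qed
qed

section \<open>Greedy construction of a cycle when every face has many extensions\<close>

lemma extend_pair:
  assumes V: "finite V" "E \<subseteq> Pow V" and E: "down_closed E"
    and rich: "\<And>A. A \<in> E \<Longrightarrow> card A = w \<Longrightarrow> d < card (nbrs E A)"
    and F: "finite F" "card F \<le> d"
  shows "A \<in> E \<Longrightarrow> card A = w \<Longrightarrow> p \<subseteq> A \<Longrightarrow>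
    \<exists>e\<in>E. card e = Suc w \<and> p \<subseteq> e \<and> (e - p) \<inter> F = {}"
proof (induction "card ((A - p) \<inter> F)" arbitrary: A rule: less_induct)
  case less
  have fA: "finite A" using less.prems(1) V by (meson PowD finite_subset subsetD)
  have "\<not> nbrs E A \<subseteq> F"
    using card_mono[OF F(1), of "nbrs E A"] rich[OF less.prems(1,2)] F(2) by linarith
  then obtain v where v: "v \<notin> A" "insert v A \<in> E" "v \<notin> F" by (auto simp: nbrs_def)
  show ?case
  proof (cases "(A - p) \<inter> F = {}")
    case True
    then show ?thesis
      using v fA less.prems by (intro bexI[of _ "insert v A"]) auto
  next
    case False
    then obtain c where c: "c \<in> A" "c \<notin> p" "c \<in> F" by blast
    \<comment> \<open>Exchange step: the forbidden vertex c is traded for v, which is not in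
      \<open>F\<close>. The face keeps its size and the pair p, and has fewer forbidden vertices
      outside p.\<close>
    define A' where "A' = insert v (A - {c})"
    have "A' \<in> E" using down_closedD[OF E v(2), of A'] by (auto simp: A'_def)
    moreover have "card A' = w"
    proof -
      have "card A' = Suc (card (A - {c}))"
        unfolding A'_def using fA v(1) by (intro card_insert_disjoint) auto
      then show ?thesis using card_Suc_Diff1[OF fA c(1)] less.prems(2) by simp
    qed
    moreover have "p \<subseteq> A'" using less.prems(3) c(2) by (auto simp: A'_def)
    moreover have "(A' - p) \<inter> F \<subseteq> (A - p) \<inter> F" "c \<in> (A - p) \<inter> F" "c \<notin> (A' - p) \<inter> F"
      using c v(3) unfolding A'_def by blast+
    then have "(A' - p) \<inter> F \<subset> (A - p) \<inter> F" by blast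
    then have "card ((A' - p) \<inter> F) < card ((A - p) \<inter> F)" using F(1) by (intro psubset_card_mono) auto
    ultimately show ?thesis using less.hyps by blast
  qed
qed

text \<open>A path in the link of \<open>B\<close>, closed up through a vertex of \<open>B\<close>, becomes a cycle of pairs, and \<open>extend_pair\<close>
  turns its pairs into edges greedily.\<close>

lemma link_path:
  assumes V: "finite V" "E \<subseteq> Pow V" and E: "down_closed E"
    and rich: "\<And>A. A \<in> E \<Longrightarrow> card A = Suc (card B) \<Longrightarrow> d < card (nbrs E A)"
    and B: "insert u B \<in> E" "u \<notin> B"
  shows "n \<le> d \<Longrightarrow> \<exists>f. inj_on f {..n} \<and> (\<forall>i\<le>n. f i \<notin> B \<and> insert (f i) B \<in> E) \<and>
    (\<forall>i<n. insert (f i) (insert (f (Suc i)) B) \<in> E)"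
proof (induction n)
  case 0
  show ?case using B by (intro exI[of _ "\<lambda>_. u"]) auto
next
  case (Suc n)
  then obtain f where f: "inj_on f {..n}" "\<forall>i\<le>n. f i \<notin> B \<and> insert (f i) B \<in> E"
    "\<forall>i<n. insert (f i) (insert (f (Suc i)) B) \<in> E" by auto
  let ?A = "insert (f n) B"
  have A: "?A \<in> E" "f n \<notin> B" using f(2) by auto
  have "finite B" using B(1) V by (meson PowD finite_insert finite_subset subsetD)
  then have "d < card (nbrs E ?A)" using rich[OF A(1)] A(2) by simp
  moreover have "card (f ` {..n}) \<le> Suc n" using card_image_le[of "{..n}" f] by simp
  ultimately have "\<not> nbrs E ?A \<subseteq> f ` {..n}"
    using card_mono[of "f ` {..n}" "nbrs E ?A"] Suc.prems by fastforce
  then obtain v where v: "v \<in> nbrs E ?A" "v \<notin> f ` {..n}" by blast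
  define f' where "f' = f(Suc n := v)"
  have old: "f' i = f i" if "i \<le> n" for i using that by (simp add: f'_def)
  have new: "f' (Suc n) = v" by (simp add: f'_def)
  have vA: "v \<notin> ?A" "insert v ?A \<in> E" using v(1) by (auto simp: nbrs_def)
  have vB: "insert v B \<in> E" using down_closedD[OF E vA(2)] by blast
  have "inj_on f' {..Suc n}"
  proof -
    have "inj_on f' {..n}" using f(1) old by (simp add: inj_on_def)
    moreover have "f' (Suc n) \<notin> f' ` {..n}" using v(2) new old by auto
    ultimately show ?thesis by (simp add: atMost_Suc)
  qed
  moreover have "\<forall>i\<le>Suc n. f' i \<notin> B \<and> insert (f' i) B \<in> E"
    using f(2) old new vA(1) vB by (auto simp: le_Suc_eq)
  moreover have "\<forall>i<Suc n. insert (f' i) (insert (f' (Suc i)) B) \<in> E"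
  proof (intro allI impI)
    fix i assume "i < Suc n"
    then consider "i = n" | "i < n" by linarith
    then show "insert (f' i) (insert (f' (Suc i)) B) \<in> E"
    proof cases
      case 1
      then show ?thesis using vA(2) old[of n] new by (simp add: insert_commute)
    next
      case 2
      then show ?thesis using f(3) old[of i] old[of "Suc i"] by simp
    qed
  qed
  ultimately show ?case by blast
qed

lemma card_consecutive_inter:
  assumes m: "(m::nat) \<ge> 3" and "i < m" "j < m" "i \<noteq> j"
  shows "card ({i, Suc i mod m} \<inter> {j, Suc j mod m}) = (if j = Suc i mod m \<or> i = Suc j mod m then 1 else 0)"
proof -
  define i' where "i' = Suc i mod m"
  define j' where "j' = Suc j mod m"
  have i': "(Suc i < m \<and> i' = Suc i) \<or> (Suc i = m \<and> i' = 0)"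
    using eq_Suc_mod_iff[OF assms(2), of i'] i'_def by blast
  have j': "(Suc j < m \<and> j' = Suc j) \<or> (Suc j = m \<and> j' = 0)"
    using eq_Suc_mod_iff[OF assms(3), of j'] j'_def by blast
  have ne: "i' \<noteq> j'" using i' j' assms(4) by linarith
  have both: "\<not> (j = i' \<and> i = j')" using i' j' m by linarith
  have "card ({i, i'} \<inter> {j, j'}) = (if j = i' \<or> i = j' then 1 else 0)"
  proof (cases "j = i' \<or> i = j'")
    case True
    then have "{i, i'} \<inter> {j, j'} = {j} \<or> {i, i'} \<inter> {j, j'} = {i}"
      using ne both assms(4) by auto
    then obtain x where x: "{i, i'} \<inter> {j, j'} = {x}" by blast
    show ?thesis unfolding x using True by simp
  next
    case False
    then have "{i, i'} \<inter> {j, j'} = {}" using ne assms(4) by auto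
    then show ?thesis using False by simp
  qed
  then show ?thesis by (simp add: i'_def j'_def)
qed

lemma rich_complex_cycle:
  assumes V: "finite V" "E \<subseteq> Pow V" and E: "down_closed E"
    and rich: "\<And>A. A \<in> E \<Longrightarrow> card A = k - 1 \<Longrightarrow> m * k + m < card (nbrs E A)"
    and k: "k \<ge> 3" and m: "m \<ge> 3" and A0: "A0 \<in> E" "card A0 = k - 1"
  shows "has_linear_cycle k m E"
proof -
  \<comment> \<open>The number of vertices to be avoided at any time: m vertices of the underlying
    cycle of pairs, and k for each of fewer than m earlier edges.\<close>
  let ?d = "m * k + m"
  have finE: "finite e" if "e \<in> E" for e using that V by (meson PowD finite_subset subsetD)
  obtain u where u: "u \<in> A0" using A0(2) k by fastforce
  define B where "B = A0 - {u}"
  have B: "insert u B = A0" "u \<notin> B" "card B = k - 2" "finite B"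
    using u A0(2) finE[OF A0(1)] by (auto simp: B_def)
  have w: "k - 1 = Suc (card B)" using B(3) k by simp
  obtain v0 where v0: "v0 \<in> B" using B(3) k by fastforce
  have "m - 2 \<le> ?d" by simp
  then obtain f where f: "inj_on f {..m - 2}" "\<forall>i\<le>m - 2. f i \<notin> B \<and> insert (f i) B \<in> E"
    "\<forall>i<m - 2. insert (f i) (insert (f (Suc i)) B) \<in> E"
    using link_path[OF V E rich[unfolded w], of B u "m - 2"] B A0(1) by auto
  \<comment> \<open>The face \<open>insert (f i) B\<close> contains both \<open>f i\<close> and
    \<open>v0\<close>, since \<open>v0\<close> is in \<open>B\<close>. Hence \<open>v0\<close> can
    be joined to both ends of the path and closes it into a cyclic sequence of m vertices.\<close>
  define h where "h = (\<lambda>j. if j = m - 1 then v0 else f j)"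
  have h_inj: "inj_on h {..<m}"
  proof (rule inj_onI)
    fix i j assume ij: "i \<in> {..<m}" "j \<in> {..<m}" "h i = h j"
    have f0: "f x \<noteq> v0" if "x < m" "x \<noteq> m - 1" for x
    proof -
      have "x \<le> m - 2" using that by simp
      then show ?thesis using f(2) v0 by metis
    qed
    show "i = j"
    proof (cases "i = m - 1 \<or> j = m - 1")
      case True
      then show ?thesis using ij f0[of i] f0[of j] by (auto simp: h_def split: if_splits)
    next
      case False
      then have "i \<le> m - 2" "j \<le> m - 2" using ij by auto
      then show ?thesis using False ij(3) f(1) by (auto simp: h_def inj_on_def)
    qed
  qed
  define p where "p = (\<lambda>j. {h j, h (Suc j mod m)})"
  have face: "\<exists>A\<in>E. card A = k - 1 \<and> p j \<subseteq> A" if j: "j < m" for j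
  proof -
    consider "j < m - 2" | "j = m - 2" | "j = m - 1" using j by linarith
    then show ?thesis
    proof cases
      case 1
      then have "Suc j < m" "j \<noteq> m - 1" "Suc j \<noteq> m - 1" by linarith+
      then have pj: "p j = {f j, f (Suc j)}" by (simp add: p_def h_def)
      \<comment> \<open>The set obtained with all of \<open>B\<close> has k vertices; dropping
        \<open>v0\<close> leaves a face of k - 1 vertices that still contains the pair.\<close>
      let ?A = "insert (f j) (insert (f (Suc j)) (B - {v0}))"
      have "?A \<in> E" by (rule down_closedD[OF E, of "insert (f j) (insert (f (Suc j)) B)"]) (use f(3) 1 in auto)
      moreover have "f j \<noteq> f (Suc j)" using inj_onD[OF f(1), of j "Suc j"] 1 by auto
      moreover have "f j \<notin> B" "f (Suc j) \<notin> B" using f(2) 1 by auto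
      ultimately show ?thesis using B(3,4) v0 k pj by (intro bexI[of _ ?A]) auto
    next
      case 2
      then have pj: "p j = {f (m - 2), v0}" using m by (auto simp: p_def h_def)
      have "insert (f (m - 2)) B \<in> E" "f (m - 2) \<notin> B" using f(2) by auto
      then show ?thesis using B(3,4) v0 k pj by (intro bexI[of _ "insert (f (m - 2)) B"]) auto
    next
      case 3
      then have pj: "p j = {v0, f 0}" using m by (auto simp: p_def h_def)
      have "insert (f 0) B \<in> E" "f 0 \<notin> B" using f(2) by auto
      then show ?thesis using B(3,4) v0 k pj by (intro bexI[of _ "insert (f 0) B"]) auto
    qed
  qed
  have greedy: "\<exists>g. \<forall>j<n. g j \<in> E \<and> card (g j) = k \<and> p j \<subseteq> g j \<and>
      (g j - p j) \<inter> (h ` {..<m} \<union> (\<Union>i<j. g i)) = {}" if "n \<le> m" for n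
    using that
  proof (induction n)
    case 0
    then show ?case by simp
  next
    case (Suc n)
    then obtain g where g: "\<forall>j<n. g j \<in> E \<and> card (g j) = k \<and> p j \<subseteq> g j \<and>
      (g j - p j) \<inter> (h ` {..<m} \<union> (\<Union>i<j. g i)) = {}" by auto
    let ?F = "h ` {..<m} \<union> (\<Union>i<n. g i)"
    have fF: "finite ?F" using g finE by auto
    have "card ?F \<le> card (h ` {..<m}) + card (\<Union>i<n. g i)" by (rule card_Un_le)
    also have "\<dots> \<le> m + (\<Sum>i<n. card (g i))"
      using card_image_le[of "{..<m}" h] card_UN_le[of "{..<n}" g] by (intro add_mono) auto
    also have "\<dots> = m + n * k" using g by simp
    also have "\<dots> \<le> ?d" using Suc.prems by simp
    finally have cF: "card ?F \<le> ?d" .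
    obtain A where A: "A \<in> E" "card A = k - 1" "p n \<subseteq> A" using face[of n] Suc.prems by auto
    obtain e where e: "e \<in> E" "card e = Suc (k - 1)" "p n \<subseteq> e" "(e - p n) \<inter> ?F = {}"
      using extend_pair[OF V E rich fF cF A] by blast
    define g' where "g' = g(n := e)"
    have old: "g' i = g i" if "i < n" for i using that by (simp add: g'_def)
    have un: "(\<Union>i<j. g' i) = (\<Union>i<j. g i)" if "j \<le> n" for j using old that by auto
    have "g' j \<in> E \<and> card (g' j) = k \<and> p j \<subseteq> g' j \<and>
      (g' j - p j) \<inter> (h ` {..<m} \<union> (\<Union>i<j. g' i)) = {}" if "j < Suc n" for j
    proof (cases "j = n")
      case True
      have "g' j = e" using True by (simp add: g'_def)
      then show ?thesis using e k True un[of n] by simp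
    next
      case False
      then have "j < n" using that by simp
      then show ?thesis using g old[of j] un[of j] by simp
    qed
    then show ?case by blast
  qed
  obtain g where g: "\<And>j. j < m \<Longrightarrow> g j \<in> E \<and> card (g j) = k \<and> p j \<subseteq> g j \<and>
      (g j - p j) \<inter> (h ` {..<m} \<union> (\<Union>i<j. g i)) = {}" using greedy[of m] by auto
  have pH: "p j \<subseteq> h ` {..<m}" if "j < m" for j using that by (auto simp: p_def)
  \<comment> \<open>The vertices added to a pair avoid the cyclic skeleton and all earlier edges, so
    edges meet exactly where their pairs meet.\<close>
  have inter: "g i \<inter> g j = p i \<inter> p j" if "i < j" "j < m" for i j
  proof -
    have i: "i < m" using that by simp
    have "g i \<subseteq> (\<Union>i<j. g i)" using that(1) by blast
    moreover have "P \<inter> Q = P' \<inter> Q'"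
      if "P \<subseteq> U" "P' \<subseteq> P" "(P - P') \<inter> H = {}" "Q' \<subseteq> Q" "(Q - Q') \<inter> U = {}" "Q' \<subseteq> H"
      for P P' Q Q' U H :: "'a set" using that by blast
    moreover have "p i \<subseteq> g i" "(g i - p i) \<inter> h ` {..<m} = {}" using g[OF i] by auto
    moreover have "p j \<subseteq> g j" "(g j - p j) \<inter> (\<Union>i<j. g i) = {}" using g[OF that(2)] by auto
    ultimately show ?thesis using pH[OF that(2)] by metis
  qed
  have inter': "g i \<inter> g j = p i \<inter> p j" if "i < m" "j < m" "i \<noteq> j" for i j
    using inter[of i j] inter[of j i] that by (cases "i < j") auto
  have "card (g i \<inter> g j) = (if j = Suc i mod m \<or> i = Suc j mod m then 1 else 0)"
    if "i < m" "j < m" "i \<noteq> j" for i j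
  proof -
    have lt: "{i, Suc i mod m} \<subseteq> {..<m}" "{j, Suc j mod m} \<subseteq> {..<m}" using that by auto
    have "p i \<inter> p j = h ` ({i, Suc i mod m} \<inter> {j, Suc j mod m})"
      unfolding p_def inj_on_image_Int[OF h_inj lt] by simp
    moreover have "inj_on h ({i, Suc i mod m} \<inter> {j, Suc j mod m})"
      by (rule inj_on_subset[OF h_inj le_infI1[OF lt(1)]])
    ultimately show ?thesis
      using card_consecutive_inter[OF m that] inter'[OF that] by (simp add: card_image)
  qed
  then have "linear_cycle_family k m g"
    using g finE unfolding linear_cycle_family_def by blast
  then show ?thesis using g unfolding has_linear_cycle_def by blast
qed

text \<open>After deletion with the large constant no face of size k - 1 survives, since it would
  start the greedy cycle; hence no larger edge survives either, and the deletion cost bounds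
  everything.\<close>

lemma card_large_faces_le:
  assumes V: "finite V" "E \<subseteq> Pow V" and E: "down_closed E"
    and k: "k \<ge> 3" and m: "m \<ge> 3" and no: "\<not> has_linear_cycle k m E"
  shows "card {e \<in> E. k - 1 \<le> card e} \<le> 2 ^ (m * k + m) * card {A \<in> E. card A = k - 1}"
proof -
  obtain E' where E': "E' \<subseteq> E" "down_closed E'" "\<forall>A\<in>E'. card A = k - 1 \<longrightarrow> m * k + m < card (nbrs E' A)"
    and le: "card {e \<in> E. k - 1 \<le> card e} + 2 ^ (m * k + m) * card {A \<in> E'. card A = k - 1}
      \<le> 2 ^ (m * k + m) * card {A \<in> E. card A = k - 1} + card {e \<in> E'. k - 1 \<le> card e}"
    using delete_poor_faces[OF V E] by meson
  have VE': "E' \<subseteq> Pow V" using E'(1) V(2) by blast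
  have "\<not> has_linear_cycle k m E'" using no has_linear_cycle_mono[OF _ E'(1)] by blast
  then have none: "card A \<noteq> k - 1" if "A \<in> E'" for A
    using rich_complex_cycle[OF V(1) VE' E'(2) _ k m that] E'(3) by blast
  have "{e \<in> E'. k - 1 \<le> card e} = {}"
  proof (rule ccontr)
    assume "{e \<in> E'. k - 1 \<le> card e} \<noteq> {}"
    then obtain e where e: "e \<in> E'" "k - 1 \<le> card e" by blast
    obtain A where "A \<subseteq> e" "card A = k - 1" using obtain_subset_with_card_n[OF e(2)] by blast
    then show False using none down_closedD[OF E'(2) e(1)] by blast
  qed
  then have "card {e \<in> E'. k - 1 \<le> card e} = 0" by (simp only: card.empty)
  then show ?thesis using le by linarith
qed

section \<open>The asymptotic upper bound for edges of size at least k - 1\<close>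

lemma binomial_le_power: "(n choose r) \<le> n ^ r"
  by (cases "r \<le> n") (simp_all add: binomial_le_pow binomial_eq_0)

text \<open>Each face is written as a triple in at least one way and receives a list of exactly t of
  its neighbours. The system starts with no common colours, so \<open>dense_system_cycle\<close> is
  used with c = 0.\<close>

lemma dense_complex_cycle:
  fixes \<delta> :: real
  assumes t: "t \<ge> 2" and k: "k \<ge> 3" and \<delta>: "\<delta> > 0"
  shows "\<exists>n0. \<forall>(V :: 'v set) E. finite V \<longrightarrow> n0 \<le> card V \<longrightarrow> E \<subseteq> Pow V \<longrightarrow>
     (\<forall>A\<in>E. card A = k - 1 \<longrightarrow> t \<le> card (nbrs E A)) \<longrightarrow>
     \<delta> * real (card V) ^ (k - 1) \<le> real (card {A \<in> E. card A = k - 1}) \<longrightarrow> has_linear_cycle k (2 * t) E"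
proof -
  define q where "q = k - 3"
  have q: "k = q + 3" using k by (simp add: q_def)
  obtain n0 where n0: "\<forall>(V :: 'v set) L C T. finite V \<longrightarrow> n0 \<le> card V \<longrightarrow> T \<subseteq> triples q V \<longrightarrow>
     \<delta> * real (card (triples q V)) \<le> real (card T) \<longrightarrow> finite C \<longrightarrow> card C = 0 \<longrightarrow>
     (\<forall>x y Z. (x, y, Z) \<in> T \<longrightarrow> admissible_edge t q L C x y Z) \<longrightarrow>
     (\<exists>g. linear_cycle_family (q + 3) (2 * t) g \<and>
        (\<forall>i<2 * t. \<exists>u\<in>T. \<exists>v\<in>L (triple_set u). g i = insert v (triple_set u)))"
    using dense_system_cycle[where 'v = 'v and q = q, OF t le0 \<delta>] ..
  show ?thesis
  proof (intro exI[of _ n0] allI impI)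
    fix V :: "'v set" and E
    assume V: "finite V" "n0 \<le> card V" "E \<subseteq> Pow V"
      and deg: "\<forall>A\<in>E. card A = k - 1 \<longrightarrow> t \<le> card (nbrs E A)"
      and dens: "\<delta> * real (card V) ^ (k - 1) \<le> real (card {A \<in> E. card A = k - 1})"
    have "\<exists>S\<subseteq>nbrs E A. card S = t" if "A \<in> E" "card A = k - 1" for A
      using obtain_subset_with_card_n[of t "nbrs E A"] deg that by metis
    then obtain L where L: "\<And>A. A \<in> E \<Longrightarrow> card A = k - 1 \<Longrightarrow> L A \<subseteq> nbrs E A \<and> card (L A) = t" by metis
    define T where "T = {(x, y, Z) \<in> triples q V. x \<noteq> y \<and> x \<notin> Z \<and> y \<notin> Z \<and> insert x (insert y Z) \<in> E}"
    have TU: "T \<subseteq> triples q V" by (auto simp: T_def)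
    have fT: "finite T" using TU finite_triples[OF V(1)] by (rule finite_subset)
    have T_edge: "finite Z" "card Z = q" "x \<noteq> y" "x \<notin> Z" "y \<notin> Z" "insert x (insert y Z) \<in> E"
      "card (insert x (insert y Z)) = k - 1" if "(x, y, Z) \<in> T" for x y Z
    proof -
      show Z: "finite Z" using that finite_subset[OF _ V(1)] by (auto simp: T_def triples_def)
      show "card Z = q" "x \<noteq> y" "x \<notin> Z" "y \<notin> Z" "insert x (insert y Z) \<in> E"
        using that by (auto simp: T_def triples_def)
      then show "card (insert x (insert y Z)) = k - 1" using Z q by simp
    qed
    have "{A \<in> E. card A = k - 1} \<subseteq> triple_set ` T"
    proof
      fix A assume "A \<in> {A \<in> E. card A = k - 1}"
      then have A: "A \<in> E" "card A = Suc (Suc q)" using q by auto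
      then obtain x A1 where x: "A = insert x A1" "x \<notin> A1" "card A1 = Suc q" by (metis card_Suc_eq)
      then obtain y Z where y: "A1 = insert y Z" "y \<notin> Z" "card Z = q" by (metis card_Suc_eq)
      have "(x, y, Z) \<in> T" using A x y V(3) by (auto simp: T_def triples_def)
      then show "A \<in> triple_set ` T" using x(1) y(1) by force
    qed
    then have "card {A \<in> E. card A = k - 1} \<le> card T" using fT by (rule surj_card_le[rotated])
    moreover have "real (card (triples q V)) \<le> real (card V) ^ (k - 1)"
    proof -
      have "card (triples q V) \<le> card V * card V * card V ^ q"
        unfolding card_triples[OF V(1)] by (intro mult_le_mono2 binomial_le_power)
      also have "\<dots> = card V ^ (k - 1)" using q by (simp add: numeral_3_eq_3)
      finally show ?thesis by (metis of_nat_mono of_nat_power)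
    qed
    then have "\<delta> * real (card (triples q V)) \<le> \<delta> * real (card V) ^ (k - 1)" using \<delta> by simp
    ultimately have cT: "\<delta> * real (card (triples q V)) \<le> real (card T)" using dens by linarith
    have adm: "admissible_edge t q L {} x y Z" if "(x, y, Z) \<in> T" for x y Z
      using T_edge[OF that] L[OF T_edge(6,7)[OF that]] by (auto simp: admissible_edge_def nbrs_def)
    obtain g where g: "linear_cycle_family (q + 3) (2 * t) g"
      "\<forall>i<2 * t. \<exists>u\<in>T. \<exists>v\<in>L (triple_set u). g i = insert v (triple_set u)"
      using n0[THEN spec, of V, THEN spec, of L, THEN spec, of "{}", THEN spec, of T] V(1,2) TU cT adm by auto
    have "g i \<in> E" if i: "i < 2 * t" for i
    proof -
      obtain u v where uv: "u \<in> T" "v \<in> L (triple_set u)" "g i = insert v (triple_set u)" using g(2) i by blast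
      obtain x y Z where u: "u = (x, y, Z)" by (cases u)
      show ?thesis using L[OF T_edge(6,7)[of x y Z]] uv unfolding u by (auto simp: nbrs_def)
    qed
    then show "has_linear_cycle k (2 * t) E" using g(1) q unfolding has_linear_cycle_def by blast
  qed
qed

lemma card_large_faces_asymptotic:
  fixes \<epsilon> :: real
  assumes t: "t \<ge> 2" and k: "k \<ge> 3" and \<epsilon>: "\<epsilon> > 0"
  shows "\<exists>n0. \<forall>(V :: 'v set) E. finite V \<longrightarrow> n0 \<le> card V \<longrightarrow> E \<subseteq> Pow V \<longrightarrow> down_closed E \<longrightarrow>
     \<not> has_linear_cycle k (2 * t) E \<longrightarrow>
     real (card {e \<in> E. k - 1 \<le> card e}) \<le> 2 ^ (t - 1) * real (card V choose (k - 1)) + \<epsilon> * real (card V) ^ (k - 1)"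
proof -
  \<comment> \<open>This is m * k + m for m = 2t, the exponent of the price per face in
    \<open>card_large_faces_le\<close>; dividing \<epsilon> by 2^D compensates for that
    price.\<close>
  define D where "D = 2 * t * k + 2 * t"
  define \<delta> where "\<delta> = \<epsilon> / 2 ^ D"
  have \<delta>: "\<delta> > 0" using \<epsilon> by (simp add: \<delta>_def)
  obtain n0 where n0: "\<forall>(V :: 'v set) E. finite V \<longrightarrow> n0 \<le> card V \<longrightarrow> E \<subseteq> Pow V \<longrightarrow>
     (\<forall>A\<in>E. card A = k - 1 \<longrightarrow> t \<le> card (nbrs E A)) \<longrightarrow>
     \<delta> * real (card V) ^ (k - 1) \<le> real (card {A \<in> E. card A = k - 1}) \<longrightarrow> has_linear_cycle k (2 * t) E"
    using dense_complex_cycle[OF t k \<delta>] ..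
  show ?thesis
  proof (intro exI[of _ n0] allI impI)
    fix V :: "'v set" and E
    assume V: "finite V" "n0 \<le> card V" "E \<subseteq> Pow V" and E: "down_closed E"
      and no: "\<not> has_linear_cycle k (2 * t) E"
    obtain E' where E': "E' \<subseteq> E" "down_closed E'" "\<forall>A\<in>E'. card A = k - 1 \<longrightarrow> t - 1 < card (nbrs E' A)"
      and le: "card {e \<in> E. k - 1 \<le> card e} + 2 ^ (t - 1) * card {A \<in> E'. card A = k - 1}
        \<le> 2 ^ (t - 1) * card {A \<in> E. card A = k - 1} + card {e \<in> E'. k - 1 \<le> card e}"
      using delete_poor_faces[OF V(1,3) E] by meson
    have VE': "E' \<subseteq> Pow V" using E'(1) V(3) by blast
    have no': "\<not> has_linear_cycle k (2 * t) E'" using no has_linear_cycle_mono[OF _ E'(1)] by blast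
    have deg: "\<forall>A\<in>E'. card A = k - 1 \<longrightarrow> t \<le> card (nbrs E' A)"
      using E'(3) by (metis Suc_diff_1 Suc_le_eq le_less_trans not_gr_zero not_less_eq_eq zero_le)
    have small: "real (card {A \<in> E'. card A = k - 1}) < \<delta> * real (card V) ^ (k - 1)"
      using n0[THEN spec, of V, THEN spec, of E'] V(1,2) VE' deg no' by (auto simp: not_le[symmetric])
    have "card {e \<in> E'. k - 1 \<le> card e} \<le> 2 ^ D * card {A \<in> E'. card A = k - 1}"
      using card_large_faces_le[OF V(1) VE' E'(2) k _ no'] t by (simp add: D_def)
    then have "real (card {e \<in> E'. k - 1 \<le> card e}) \<le> real (2 ^ D * card {A \<in> E'. card A = k - 1})"
      by (rule of_nat_mono)
    also have "\<dots> \<le> 2 ^ D * (\<delta> * real (card V) ^ (k - 1))" using small by simp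
    also have "\<dots> = \<epsilon> * real (card V) ^ (k - 1)" by (simp add: \<delta>_def)
    finally have 1: "real (card {e \<in> E'. k - 1 \<le> card e}) \<le> \<epsilon> * real (card V) ^ (k - 1)" .
    have "card {A \<in> E. card A = k - 1} \<le> card {A. A \<subseteq> V \<and> card A = k - 1}"
      using V(1,3) by (intro card_mono) auto
    also have "\<dots> = card V choose (k - 1)" by (rule n_subsets[OF V(1)])
    finally have "2 ^ (t - 1) * card {A \<in> E. card A = k - 1} \<le> 2 ^ (t - 1) * (card V choose (k - 1))"
      by (rule mult_le_mono2)
    then have "card {e \<in> E. k - 1 \<le> card e} \<le> 2 ^ (t - 1) * (card V choose (k - 1)) + card {e \<in> E'. k - 1 \<le> card e}"
      using le by linarith
    from of_nat_mono[OF this, where 'a = real]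
    have "real (card {e \<in> E. k - 1 \<le> card e})
        \<le> 2 ^ (t - 1) * real (card V choose (k - 1)) + real (card {e \<in> E'. k - 1 \<le> card e})" by simp
    then show "real (card {e \<in> E. k - 1 \<le> card e})
        \<le> 2 ^ (t - 1) * real (card V choose (k - 1)) + \<epsilon> * real (card V) ^ (k - 1)"
      using 1 by linarith
  qed
qed

section \<open>Extremal numbers\<close>

lemma simplicial_complex_down_closed:
  assumes "simplicial_complex G"
  shows "finite (verts G)" "edges G \<subseteq> Pow (verts G)" "down_closed (edges G)"
  using assms by (auto simp: simplicial_complex_def hypergraph_def down_closed_def)

lemma card_small_faces_le:
  assumes "finite V" "E \<subseteq> Pow V"
  shows "card {e \<in> E. card e < w} \<le> (\<Sum>r<w. card V choose r)"
proof -
  have "{e \<in> E. card e < w} \<subseteq> (\<Union>r<w. {A. A \<subseteq> V \<and> card A = r})" using assms(2) by auto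
  then have "card {e \<in> E. card e < w} \<le> card (\<Union>r<w. {A. A \<subseteq> V \<and> card A = r})"
    using assms(1) by (intro card_mono) auto
  also have "\<dots> \<le> (\<Sum>r<w. card {A. A \<subseteq> V \<and> card A = r})" by (rule card_UN_le) simp
  also have "\<dots> = (\<Sum>r<w. card V choose r)" using n_subsets[OF assms(1)] by simp
  finally show ?thesis .
qed

lemma card_subsets_less:
  assumes "finite V"
  shows "card {e. e \<subseteq> V \<and> card e < w} = (\<Sum>r<w. card V choose r)"
proof -
  have "{e. e \<subseteq> V \<and> card e < w} = (\<Union>r<w. {A. A \<subseteq> V \<and> card A = r})" by auto
  also have "card \<dots> = (\<Sum>r<w. card {A. A \<subseteq> V \<and> card A = r})"
    using assms by (intro card_UN_disjoint) auto
  also have "\<dots> = (\<Sum>r<w. card V choose r)" using n_subsets[OF assms] by simp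
  finally show ?thesis .
qed

text \<open>Edges with fewer than k - 1 vertices are estimated trivially by all such sets, which
  amounts to O(n^(k-2)).\<close>

lemma card_edges_asymptotic:
  fixes \<epsilon> :: real
  assumes t: "t \<ge> 2" and k: "k \<ge> 3" and C: "is_linear_cycle k (2 * t) C"
    and F: "contains_copy (downset_complex C) F" and \<epsilon>: "\<epsilon> > 0"
  shows "\<exists>n0. \<forall>G :: 'v hypergraph. simplicial_complex G \<longrightarrow> n0 \<le> card (verts G) \<longrightarrow> \<not> contains_copy G F \<longrightarrow>
    real (card (edges G)) \<le> real (\<Sum>r<k - 1. card (verts G) choose r)
      + 2 ^ (t - 1) * real (card (verts G) choose (k - 1)) + \<epsilon> * real (card (verts G)) ^ (k - 1)"
proof -
  obtain n0 where n0: "\<forall>(V :: 'v set) E. finite V \<longrightarrow> n0 \<le> card V \<longrightarrow> E \<subseteq> Pow V \<longrightarrow> down_closed E \<longrightarrow>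
     \<not> has_linear_cycle k (2 * t) E \<longrightarrow>
     real (card {e \<in> E. k - 1 \<le> card e}) \<le> 2 ^ (t - 1) * real (card V choose (k - 1)) + \<epsilon> * real (card V) ^ (k - 1)"
    using card_large_faces_asymptotic[OF t k \<epsilon>] ..
  show ?thesis
  proof (intro exI[of _ n0] allI impI)
    fix G :: "'v hypergraph"
    assume G: "simplicial_complex G" and n: "n0 \<le> card (verts G)" and no: "\<not> contains_copy G F"
    note GV = simplicial_complex_down_closed[OF G]
    have "\<not> has_linear_cycle k (2 * t) (edges G)"
    proof
      assume "has_linear_cycle k (2 * t) (edges G)"
      then obtain g where g: "linear_cycle_family k (2 * t) g" "\<And>i. i < 2 * t \<Longrightarrow> g i \<in> edges G"
        unfolding has_linear_cycle_def by blast
      have "4 \<le> 2 * t" using t by simp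
      from contains_copy_downset_linear_cycle[OF C this G g] show False
        using contains_copy_trans[OF _ F] no by blast
    qed
    then have 1: "real (card {e \<in> edges G. k - 1 \<le> card e})
        \<le> 2 ^ (t - 1) * real (card (verts G) choose (k - 1)) + \<epsilon> * real (card (verts G)) ^ (k - 1)"
      using n0[THEN spec, of "verts G", THEN spec, of "edges G"] GV n by simp
    have "edges G = {e \<in> edges G. card e < k - 1} \<union> {e \<in> edges G. k - 1 \<le> card e}" by auto
    then have "card (edges G) \<le> card {e \<in> edges G. card e < k - 1} + card {e \<in> edges G. k - 1 \<le> card e}"
      by (metis card_Un_le)
    then have "card (edges G) \<le> (\<Sum>r<k - 1. card (verts G) choose r) + card {e \<in> edges G. k - 1 \<le> card e}"
      using card_small_faces_le[OF GV(1,2), of "k - 1"] by linarith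
    from of_nat_mono[OF this, where 'a = real]
    have "real (card (edges G)) \<le> real (\<Sum>r<k - 1. card (verts G) choose r) + real (card {e \<in> edges G. k - 1 \<le> card e})"
      by (simp only: of_nat_add)
    then show "real (card (edges G)) \<le> real (\<Sum>r<k - 1. card (verts G) choose r)
      + 2 ^ (t - 1) * real (card (verts G) choose (k - 1)) + \<epsilon> * real (card (verts G)) ^ (k - 1)"
      using 1 by linarith
  qed
qed

text \<open>Infinitely many complexes on n natural numbers compete, but their edge counts are
  bounded, which gives the \<open>Max\<close> in \<open>ex_complex\<close> its meaning.\<close>

lemma finite_complex_counts:
  "finite {card (edges G) |G :: nat hypergraph. simplicial_complex G \<and> card (verts G) = n \<and> \<not> contains_copy G F}"
proof (rule finite_subset)
  show "{card (edges G) |G :: nat hypergraph. simplicial_complex G \<and> card (verts G) = n \<and> \<not> contains_copy G F}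
    \<subseteq> {..2 ^ n}"
  proof
    fix x assume "x \<in> {card (edges G) |G :: nat hypergraph. simplicial_complex G \<and> card (verts G) = n \<and> \<not> contains_copy G F}"
    then obtain G :: "nat hypergraph" where G: "x = card (edges G)" "simplicial_complex G" "card (verts G) = n" by blast
    have "card (edges G) \<le> card (Pow (verts G))"
      using simplicial_complex_down_closed[OF G(2)] by (intro card_mono) auto
    then show "x \<in> {..2 ^ n}" using G simplicial_complex_down_closed(1)[OF G(2)] by (simp add: card_Pow)
  qed
qed simp

lemma finite_clique_counts:
  "finite {card {T. is_clique k G T \<and> k \<le> card T} |G :: nat hypergraph.
      uniform k G \<and> card (verts G) = n \<and> \<not> contains_copy G H}"
proof (rule finite_subset)
  show "{card {T. is_clique k G T \<and> k \<le> card T} |G :: nat hypergraph.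
      uniform k G \<and> card (verts G) = n \<and> \<not> contains_copy G H} \<subseteq> {..2 ^ n}"
  proof
    fix x assume "x \<in> {card {T. is_clique k G T \<and> k \<le> card T} |G :: nat hypergraph.
      uniform k G \<and> card (verts G) = n \<and> \<not> contains_copy G H}"
    then obtain G :: "nat hypergraph" where G: "x = card {T. is_clique k G T \<and> k \<le> card T}"
      "uniform k G" "card (verts G) = n" by blast
    have f: "finite (verts G)" using G(2) by (simp add: uniform_def hypergraph_def)
    have "card {T. is_clique k G T \<and> k \<le> card T} \<le> card (Pow (verts G))"
      using f by (intro card_mono) (auto simp: is_clique_def)
    then show "x \<in> {..2 ^ n}" using G f by (simp add: card_Pow)
  qed
qed simp

section \<open>Lower bounds from clique complexes and stars\<close>

definition clique_complex :: "nat \<Rightarrow> 'a hypergraph \<Rightarrow> 'a hypergraph" where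
  "clique_complex k G =
     Hypergraph (verts G) ({e. e \<subseteq> verts G \<and> card e < k} \<union> {T. is_clique k G T \<and> k \<le> card T})"

text \<open>A clique with at least k >= 2 vertices is no singleton, so it is a clique by one of the
  two clauses that pass to subsets.\<close>

lemma simplicial_clique_complex:
  assumes G: "uniform k G" and k: "k \<ge> 2"
  shows "simplicial_complex (clique_complex k G)"
proof -
  have fin: "finite (verts G)" using G by (simp add: uniform_def hypergraph_def)
  have clique_sub: "is_clique k G e'" if h: "is_clique k G e" "k \<le> card e" "e' \<subseteq> e" for e e'
  proof -
    have "\<not> (\<exists>v. e = {v})" using h(2) k by auto
    then consider d where "d \<in> edges G" "e \<subseteq> d" | "\<forall>s. s \<subseteq> e \<and> card s = k \<longrightarrow> s \<in> edges G"
      using h(1) unfolding is_clique_def by blast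
    moreover have "e' \<subseteq> verts G" using h(1,3) by (auto simp: is_clique_def)
    ultimately show ?thesis
    proof cases
      case 1
      then have "e' \<subseteq> d" using h(3) by blast
      then show ?thesis using \<open>e' \<subseteq> verts G\<close> 1(1) unfolding is_clique_def by blast
    next
      case 2
      have "\<forall>s. s \<subseteq> e' \<and> card s = k \<longrightarrow> s \<in> edges G"
      proof (intro allI impI)
        fix s assume "s \<subseteq> e' \<and> card s = k"
        then show "s \<in> edges G" using 2[rule_format, of s] h(3) by blast
      qed
      then show ?thesis using \<open>e' \<subseteq> verts G\<close> unfolding is_clique_def by blast
    qed
  qed
  have sub: "edges (clique_complex k G) \<subseteq> Pow (verts G)"
    by (auto simp: clique_complex_def is_clique_def)
  have "e' \<in> edges (clique_complex k G)" if e: "e \<in> edges (clique_complex k G)" "e' \<subseteq> e" for e e'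
  proof -
    have eV: "e \<subseteq> verts G" using e(1) sub by blast
    show ?thesis
    proof (cases "card e' < k")
      case True
      then show ?thesis using eV e(2) by (auto simp: clique_complex_def)
    next
      case False
      moreover have "card e' \<le> card e" using card_mono[OF finite_subset[OF eV fin] e(2)] .
      ultimately have "is_clique k G e" "k \<le> card e" using e(1) by (auto simp: clique_complex_def)
      then show ?thesis using clique_sub[OF _ _ e(2)] False by (simp add: clique_complex_def)
    qed
  qed
  moreover have "verts (clique_complex k G) = verts G" by (simp add: clique_complex_def)
  moreover have "{} \<in> edges (clique_complex k G)" "\<forall>v\<in>verts G. {v} \<in> edges (clique_complex k G)"
    using k by (auto simp: clique_complex_def)
  ultimately show ?thesis using fin sub unfolding simplicial_complex_def hypergraph_def by simp
qed

text \<open>A clique with exactly k vertices is an edge, so the layer of k-sets in the clique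
  complex is \<open>G\<close> again.\<close>

lemma contains_copy_clique_complex:
  assumes G: "uniform k G" and k: "k \<ge> 2" and F: "hypergraph F"
    and copy: "contains_copy (clique_complex k G) F"
  shows "contains_copy G (layer k F)"
proof -
  obtain f where f: "inj_on f (verts F)" "f ` verts F \<subseteq> verts G"
    "\<forall>e\<in>edges F. f ` e \<in> edges (clique_complex k G)"
    using copy by (auto simp: contains_copy_def clique_complex_def)
  have "f ` e \<in> edges G" if e: "e \<in> edges F" "card e = k" for e
  proof -
    have "e \<subseteq> verts F" using F e(1) by (auto simp: hypergraph_def)
    then have c: "card (f ` e) = k" using card_image[OF inj_on_subset[OF f(1)]] e(2) by blast
    moreover have "f ` e \<in> edges (clique_complex k G)" using f(3) e(1) by blast
    ultimately have "is_clique k G (f ` e)" by (simp add: clique_complex_def)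
    moreover have "\<not> (\<exists>v. f ` e = {v})" using c k by auto
    ultimately consider d where "d \<in> edges G" "f ` e \<subseteq> d" | "\<forall>s. s \<subseteq> f ` e \<and> card s = k \<longrightarrow> s \<in> edges G"
      unfolding is_clique_def by blast
    then show ?thesis
    proof cases
      case 1
      have "finite d" "card d = k"
        using G 1(1) finite_subset[of d "verts G"] by (auto simp: uniform_def hypergraph_def)
      then have "f ` e = d" using card_subset_eq[of d "f ` e"] 1(2) c by simp
      then show ?thesis using 1(1) by simp
    next
      case 2
      then show ?thesis using c by blast
    qed
  qed
  then show ?thesis using f(1,2) unfolding contains_copy_def by (auto simp: layer_def)
qed

lemma card_edges_clique_complex:
  assumes G: "uniform k G"
  shows "card (edges (clique_complex k G)) =
    (\<Sum>r<k. card (verts G) choose r) + card {T. is_clique k G T \<and> k \<le> card T}"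
proof -
  have fin: "finite (verts G)" using G by (simp add: uniform_def hypergraph_def)
  have "finite {T. is_clique k G T \<and> k \<le> card T}"
    by (rule finite_subset[of _ "Pow (verts G)"]) (use fin in \<open>auto simp: is_clique_def\<close>)
  then have "card (edges (clique_complex k G)) =
      card {e. e \<subseteq> verts G \<and> card e < k} + card {T. is_clique k G T \<and> k \<le> card T}"
    unfolding clique_complex_def hypergraph.sel using fin by (intro card_Un_disjoint) auto
  then show ?thesis using card_subsets_less[OF fin] by simp
qed

text \<open>The extremal example has p = t - 1. For p = 0 there are no edges, and that case shows
  that the sets under \<open>Max\<close> are nonempty.\<close>

definition star_hypergraph :: "nat \<Rightarrow> nat \<Rightarrow> nat \<Rightarrow> nat hypergraph" where
  "star_hypergraph k p n = Hypergraph {..<n} {e. e \<subseteq> {..<n} \<and> card e = k \<and> e \<inter> {..<p} \<noteq> {}}"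

lemma uniform_star_hypergraph: "uniform k (star_hypergraph k p n)"
  by (auto simp: uniform_def hypergraph_def star_hypergraph_def)

text \<open>Pigeonhole: disjoint edges have different vertices in the core
  \<open>{..<p}\<close>.\<close>

lemma star_hypergraph_matching_free:
  assumes M: "is_matching k t M" and t: "p < t"
  shows "\<not> contains_copy (star_hypergraph k p n) M"
proof
  assume "contains_copy (star_hypergraph k p n) M"
  then obtain f where f: "inj_on f (verts M)" "\<forall>e\<in>edges M. f ` e \<in> edges (star_hypergraph k p n)"
    by (auto simp: contains_copy_def)
  have sub: "e \<subseteq> verts M" if "e \<in> edges M" for e
    using M that by (auto simp: is_matching_def uniform_def hypergraph_def)
  have "\<exists>v. v \<in> e \<and> f v < p" if "e \<in> edges M" for e
    using f(2) that by (fastforce simp: star_hypergraph_def)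
  then obtain s where s: "\<And>e. e \<in> edges M \<Longrightarrow> s e \<in> e \<and> f (s e) < p" by metis
  have "inj_on (\<lambda>e. f (s e)) (edges M)"
  proof (rule inj_onI, rule ccontr)
    fix e e' assume e: "e \<in> edges M" "e' \<in> edges M" "f (s e) = f (s e')" "e \<noteq> e'"
    have "s e = s e'" by (rule inj_onD[OF f(1) e(3)]) (use s e(1,2) sub in blast)+
    then have "e \<inter> e' \<noteq> {}" using s[OF e(1)] s[OF e(2)] by auto
    then show False using M e by (auto simp: is_matching_def)
  qed
  moreover have "(\<lambda>e. f (s e)) ` edges M \<subseteq> {..<p}" using s by auto
  ultimately have "card (edges M) \<le> card {..<p}" by (rule card_inj_on_le) simp
  then show False using M t by (simp add: is_matching_def)
qed

text \<open>Take a nonempty part R of the core and k - 1 vertices outside: k vertices do not fit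
  into the outer part, so every k-subset meets the core. R = {} is excluded because it gives sets of
  size k - 1, which the clique complex counts among its small sets.\<close>

lemma card_cliques_star_hypergraph:
  assumes k: "k \<ge> 1" and p: "p \<le> n"
  shows "(2 ^ p - 1) * ((n - p) choose (k - 1))
    \<le> card {T. is_clique k (star_hypergraph k p n) T \<and> k \<le> card T}"
proof -
  let ?R = "Pow {..<p} - {{}}"
  let ?Q = "{Q. Q \<subseteq> {p..<n} \<and> card Q = k - 1}"
  have "card (?R \<times> ?Q) = (2 ^ p - 1) * ((n - p) choose (k - 1))"
    using n_subsets[of "{p..<n}" "k - 1"] by (simp add: card_cartesian_product card_Pow)
  moreover have "card (?R \<times> ?Q) \<le> card {T. is_clique k (star_hypergraph k p n) T \<and> k \<le> card T}"
  proof (rule card_inj_on_le)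
    show "inj_on (\<lambda>(R, Q). R \<union> Q) (?R \<times> ?Q)"
    proof (rule inj_onI)
      fix x y assume xy: "x \<in> ?R \<times> ?Q" "y \<in> ?R \<times> ?Q"
        "(case x of (R, Q) \<Rightarrow> R \<union> Q) = (case y of (R, Q) \<Rightarrow> R \<union> Q)"
      obtain R Q R' Q' where eq: "x = (R, Q)" "y = (R', Q')" by (cases x, cases y)
      then have a: "R \<subseteq> {..<p}" "Q \<subseteq> {p..<n}" "R' \<subseteq> {..<p}" "Q' \<subseteq> {p..<n}" "R \<union> Q = R' \<union> Q'"
        using xy by auto
      have "R = (R \<union> Q) \<inter> {..<p}" "R' = (R' \<union> Q') \<inter> {..<p}"
        "Q = (R \<union> Q) \<inter> {p..<n}" "Q' = (R' \<union> Q') \<inter> {p..<n}" using a(1-4) by auto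
      then show "x = y" using a(5) eq by simp
    qed
    show "(\<lambda>(R, Q). R \<union> Q) ` (?R \<times> ?Q) \<subseteq> {T. is_clique k (star_hypergraph k p n) T \<and> k \<le> card T}"
    proof
      fix x assume "x \<in> (\<lambda>(R, Q). R \<union> Q) ` (?R \<times> ?Q)"
      then obtain R Q where x: "x = R \<union> Q"
        and a: "R \<subseteq> {..<p}" "R \<noteq> {}" "Q \<subseteq> {p..<n}" "card Q = k - 1" by auto
      have fin: "finite R" "finite Q" using a finite_subset by blast+
      have "R \<inter> Q = {}" using a(1,3) by fastforce
      then have "card (R \<union> Q) = card R + card Q" using fin by (intro card_Un_disjoint)
      moreover have "card R \<ge> 1" using a(2) fin by (simp add: Suc_le_eq card_gt_0_iff)
      ultimately have "k \<le> card (R \<union> Q)" using a(4) by linarith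
      moreover have "s \<inter> {..<p} \<noteq> {}" if "s \<subseteq> R \<union> Q" "card s = k" for s
      proof
        assume "s \<inter> {..<p} = {}"
        then have "s \<subseteq> Q" using that(1) a(1) by blast
        then have "card s \<le> card Q" using fin(2) by (intro card_mono)
        then show False using that(2) a(4) k by simp
      qed
      moreover have RQ: "R \<union> Q \<subseteq> {..<n}" using a(1,3) p by auto
      ultimately show "x \<in> {T. is_clique k (star_hypergraph k p n) T \<and> k \<le> card T}"
        unfolding is_clique_def star_hypergraph_def x by auto
    qed
    show "finite {T. is_clique k (star_hypergraph k p n) T \<and> k \<le> card T}"
      by (rule finite_subset[of _ "Pow {..<n}"]) (auto simp: is_clique_def star_hypergraph_def)
  qed
  ultimately show ?thesis by simp
qed

lemma ex_clique_ge:
  assumes M: "is_matching k t M" and F: "contains_copy (layer k F) M"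
    and k: "k \<ge> 1" and t: "t \<ge> 1" and n: "t - 1 \<le> n"
  shows "(2 ^ (t - 1) - 1) * ((n - (t - 1)) choose (k - 1)) \<le> ex_clique k n (layer k F)"
proof -
  let ?G = "star_hypergraph k (t - 1) n"
  have "\<not> contains_copy ?G (layer k F)"
    using star_hypergraph_matching_free[OF M, of "t - 1"] contains_copy_trans[OF _ F] t by fastforce
  then have "card {T. is_clique k ?G T \<and> k \<le> card T} \<le> ex_clique k n (layer k F)"
    unfolding ex_clique_def
    using uniform_star_hypergraph[of k "t - 1" n]
    by (intro Max_ge finite_clique_counts CollectI exI[of _ ?G]) (simp add: star_hypergraph_def)
  then show ?thesis using card_cliques_star_hypergraph[OF k n] by linarith
qed

text \<open>The clique complex of an optimal k-graph competes for \<open>ex_complex\<close>; all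
  sets with fewer than k vertices come for free.\<close>

lemma ex_complex_ge_ex_clique:
  assumes M: "is_matching k t M" and MF: "contains_copy (layer k F) M"
    and k: "k \<ge> 2" and t: "t \<ge> 1" and F: "hypergraph F"
  shows "ex_clique k n (layer k F) + (\<Sum>r<k. n choose r) \<le> ex_complex n F"
proof -
  let ?S = "{card {T. is_clique k G T \<and> k \<le> card T} |G :: nat hypergraph.
      uniform k G \<and> card (verts G) = n \<and> \<not> contains_copy G (layer k F)}"
  have "\<not> contains_copy (star_hypergraph k 0 n) (layer k F)"
    using star_hypergraph_matching_free[OF M, of 0] contains_copy_trans[OF _ MF] t by fastforce
  then have "card {T. is_clique k (star_hypergraph k 0 n) T \<and> k \<le> card T} \<in> ?S"
    using uniform_star_hypergraph[of k 0 n]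
    by (intro CollectI exI[of _ "star_hypergraph k 0 n"]) (simp add: star_hypergraph_def)
  then have "?S \<noteq> {}" by blast
  then have "ex_clique k n (layer k F) \<in> ?S" unfolding ex_clique_def by (intro Max_in finite_clique_counts)
  then obtain G :: "nat hypergraph" where G: "ex_clique k n (layer k F) = card {T. is_clique k G T \<and> k \<le> card T}"
    "uniform k G" "card (verts G) = n" "\<not> contains_copy G (layer k F)" by blast
  have v: "verts (clique_complex k G) = verts G" by (simp add: clique_complex_def)
  have "card (edges (clique_complex k G)) \<le> ex_complex n F"
    unfolding ex_complex_def
  proof (intro Max_ge finite_complex_counts CollectI exI conjI)
    show "simplicial_complex (clique_complex k G)" by (rule simplicial_clique_complex[OF G(2) k])
    show "\<not> contains_copy (clique_complex k G) F"
      using contains_copy_clique_complex[OF G(2) k F] G(4) by blast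
  qed (use G(3) v in auto)
  then show ?thesis using card_edges_clique_complex[OF G(2)] G(1,3) by simp
qed

lemma ex_complex_le:
  fixes \<epsilon> :: real
  assumes t: "t \<ge> 2" and k: "k \<ge> 3" and C: "is_linear_cycle k (2 * t) C"
    and FC: "contains_copy (downset_complex C) F" and \<epsilon>: "\<epsilon> > 0"
    and M: "is_matching k t M" and MF: "contains_copy (layer k F) M" and F: "hypergraph F"
  shows "\<exists>n0. \<forall>n\<ge>n0. real (ex_complex n F) \<le> real (\<Sum>r<k - 1. n choose r)
      + 2 ^ (t - 1) * real (n choose (k - 1)) + \<epsilon> * real n ^ (k - 1)"
proof -
  obtain n0 where n0: "\<forall>G :: nat hypergraph. simplicial_complex G \<longrightarrow> n0 \<le> card (verts G) \<longrightarrow> \<not> contains_copy G F \<longrightarrow>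
    real (card (edges G)) \<le> real (\<Sum>r<k - 1. card (verts G) choose r)
      + 2 ^ (t - 1) * real (card (verts G) choose (k - 1)) + \<epsilon> * real (card (verts G)) ^ (k - 1)"
    using card_edges_asymptotic[OF t k C FC \<epsilon>] ..
  show ?thesis
  proof (intro exI[of _ n0] allI impI)
    fix n assume n: "n0 \<le> n"
    let ?S = "{card (edges G) |G :: nat hypergraph. simplicial_complex G \<and> card (verts G) = n \<and> \<not> contains_copy G F}"
    let ?G = "clique_complex k (star_hypergraph k 0 n)"
    have k2: "k \<ge> 2" and t0: "0 < t" using k t by auto
    have "\<not> contains_copy ?G F"
      using contains_copy_clique_complex[OF uniform_star_hypergraph k2 F]
        star_hypergraph_matching_free[OF M t0] contains_copy_trans[OF _ MF] by blast
    then have "card (edges ?G) \<in> ?S"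
      using simplicial_clique_complex[OF uniform_star_hypergraph k2, of 0 n]
      by (intro CollectI exI[of _ ?G]) (simp add: clique_complex_def star_hypergraph_def)
    then have "?S \<noteq> {}" by blast
    then have "ex_complex n F \<in> ?S" unfolding ex_complex_def by (intro Max_in finite_complex_counts)
    then obtain G :: "nat hypergraph" where "ex_complex n F = card (edges G)" "simplicial_complex G"
      "card (verts G) = n" "\<not> contains_copy G F" by blast
    then show "real (ex_complex n F) \<le> real (\<Sum>r<k - 1. n choose r)
      + 2 ^ (t - 1) * real (n choose (k - 1)) + \<epsilon> * real n ^ (k - 1)"
      using n0 n by metis
  qed
qed

section \<open>Error estimates and conclusion\<close>

lemma binomial_shift_le:
  "p \<le> n \<Longrightarrow> (n choose Suc w) \<le> ((n - p) choose Suc w) + p * n ^ w"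
proof (induction p)
  case (Suc p)
  then obtain m where m: "n - p = Suc m" by (metis Suc_diff_Suc Suc_le_lessD)
  have "m choose w \<le> m ^ w" by (rule binomial_le_power)
  also have "m ^ w \<le> n ^ w" using m by (intro power_mono) auto
  finally have "(Suc m choose Suc w) \<le> (m choose Suc w) + n ^ w" by simp
  moreover have "n - Suc p = m" using m by simp
  ultimately show ?case using Suc m by simp
qed simp

lemma sum_binomial_le: "n \<ge> 1 \<Longrightarrow> (\<Sum>r<Suc w. n choose r) \<le> Suc w * n ^ w"
proof -
  assume n: "n \<ge> 1"
  have "(\<Sum>r<Suc w. n choose r) \<le> (\<Sum>r<Suc w. n ^ w)"
  proof (rule sum_mono)
    fix r assume "r \<in> {..<Suc w}"
    then have "n ^ r \<le> n ^ w" using n by (intro power_increasing) auto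
    then show "n choose r \<le> n ^ w" using binomial_le_power[of n r] by linarith
  qed
  then show ?thesis by simp
qed

text \<open>The term of order n^w has a fixed constant and is absorbed for large n; each of the two
  terms gets half of the permitted constant.\<close>

lemma smallo_powerI:
  fixes f :: "nat \<Rightarrow> real" and K :: real
  assumes "\<And>\<epsilon>. \<epsilon> > 0 \<Longrightarrow> \<exists>n0. \<forall>n\<ge>n0. \<bar>f n\<bar> \<le> K * real n ^ w + \<epsilon> * real n ^ Suc w"
  shows "f \<in> o(\<lambda>n. real n ^ Suc w)"
proof (rule landau_o.smallI)
  fix c :: real assume c: "c > 0"
  obtain n0 where n0: "\<forall>n\<ge>n0. \<bar>f n\<bar> \<le> K * real n ^ w + (c / 2) * real n ^ Suc w"
    using assms[of "c / 2"] c by auto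
  show "\<forall>\<^sub>F n in sequentially. norm (f n) \<le> c * norm (real n ^ Suc w)"
  proof (rule eventually_sequentiallyI[of "n0 + nat \<lceil>2 * K / c\<rceil>"])
    fix n assume n: "n0 + nat \<lceil>2 * K / c\<rceil> \<le> n"
    then have "2 * K / c \<le> real n" by linarith
    then have "K \<le> (c / 2) * real n" using c by (simp add: field_simps)
    then have "K * real n ^ w \<le> (c / 2) * real n * real n ^ w" by (intro mult_right_mono) auto
    moreover have "(c / 2) * real n * real n ^ w = (c / 2) * real n ^ Suc w" by simp
    moreover have "\<bar>f n\<bar> \<le> K * real n ^ w + (c / 2) * real n ^ Suc w" using n0 n by simp
    moreover have "c * real n ^ Suc w = (c / 2) * real n ^ Suc w + (c / 2) * real n ^ Suc w" by (simp add: field_simps)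
    ultimately have "\<bar>f n\<bar> \<le> c * real n ^ Suc w" by linarith
    then show "norm (f n) \<le> c * norm (real n ^ Suc w)" by (simp add: abs_mult)
  qed
qed

theorem theorem1p6:
  fixes k t :: nat
    and F :: "'a hypergraph" and M :: "'b hypergraph" and C :: "'c hypergraph"
  assumes "k \<ge> 3" and "t \<ge> 2"
    and "simplicial_complex F" and "complex_dim F = int k - 1"
    and "is_matching k t M" and "contains_copy (layer k F) M"
    and "is_linear_cycle k (2 * t) C" and "contains_copy (downset_complex C) F"
  shows "asymptotically_trivial k F \<and>
    (\<lambda>n. real (ex_complex n F) -
          (\<Sum>r=0..t-1. real ((t - 1) choose r) * real (n choose (k - 1))))
      \<in> o(\<lambda>n. real n ^ (k - 1))"
proof -
  define w where "w = k - 2"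
  have w: "k - 1 = Suc w" "{0..k - 1} = {..<k}" "k = Suc (Suc w)"
    using assms(1) by (auto simp: w_def)
  define B :: real where "B = 2 ^ (t - 1)"
  have B: "B \<ge> 1" by (simp add: B_def)
  \<comment> \<open>The first summand is the cost of replacing n - (t - 1) by n in the count of star
    cliques, the second bounds the sets with fewer than k - 1 vertices.\<close>
  define K where "K = (B - 1) * real (t - 1) + real (Suc w)"
  have hF: "hypergraph F" using assms(3) by (simp add: simplicial_complex_def)
  have k: "k \<ge> 1" "k \<ge> 2" and t: "t \<ge> 1" using assms(1,2) by auto
  have bounds: "\<exists>n0. \<forall>n\<ge>n0. \<bar>real (ex_complex n F) - (real (ex_clique k n (layer k F)) + real (\<Sum>r<k. n choose r))\<bar>
        \<le> K * real n ^ w + \<epsilon> * real n ^ Suc w \<and>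
      \<bar>real (ex_complex n F) - B * real (n choose Suc w)\<bar> \<le> K * real n ^ w + \<epsilon> * real n ^ Suc w"
    if \<epsilon>: "\<epsilon> > 0" for \<epsilon>
  proof -
    obtain n0 where n0: "\<forall>n\<ge>n0. real (ex_complex n F) \<le> real (\<Sum>r<k - 1. n choose r)
      + 2 ^ (t - 1) * real (n choose (k - 1)) + \<epsilon> * real n ^ (k - 1)"
      using ex_complex_le[OF assms(2,1,7,8) \<epsilon> assms(5,6) hF] ..
    show ?thesis
    proof (intro exI[of _ "n0 + t"] allI impI)
      fix n assume n: "n0 + t \<le> n"
      define s where "s = real (\<Sum>r<Suc w. n choose r)"
      define b where "b = real (n choose Suc w)"
      define b' where "b' = real ((n - (t - 1)) choose Suc w)"
      define a where "a = real (ex_complex n F)"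
      define c where "c = real (ex_clique k n (layer k F))"
      have n1: "n \<ge> 1" "t - 1 \<le> n" using n t by auto
      have up: "a \<le> s + B * b + \<epsilon> * real n ^ Suc w"
        using n0 n by (simp add: a_def s_def b_def B_def w)
      have sum_k: "real (\<Sum>r<k. n choose r) = s + b" by (simp add: w(3) s_def b_def)
      have "c + (s + b) \<le> a"
        using of_nat_mono[OF ex_complex_ge_ex_clique[OF assms(5,6) k(2) t hF, of n], where 'a = real]
        unfolding of_nat_add sum_k a_def c_def .
      moreover have "(B - 1) * b' \<le> c"
        using of_nat_mono[OF ex_clique_ge[OF assms(5,6) k(1) t n1(2)], where 'a = real]
        by (simp add: B_def b'_def c_def w of_nat_diff)
      moreover have "b \<le> b' + real (t - 1) * real n ^ w"
        using of_nat_mono[OF binomial_shift_le[OF n1(2), of w], where 'a = real] by (simp add: b_def b'_def)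
      then have "(B - 1) * b \<le> (B - 1) * b' + (B - 1) * (real (t - 1) * real n ^ w)"
        using mult_left_mono[of b "b' + real (t - 1) * real n ^ w" "B - 1"] B by (simp add: distrib_left)
      moreover have "s \<le> real (Suc w) * real n ^ w"
        using of_nat_mono[OF sum_binomial_le[OF n1(1), of w], where 'a = real]
        by (simp add: s_def distrib_right)
      moreover have "K * real n ^ w = (B - 1) * (real (t - 1) * real n ^ w) + real (Suc w) * real n ^ w"
        by (simp only: K_def distrib_right mult.assoc)
      moreover have "(B - 1) * b = B * b - b" by (simp add: left_diff_distrib)
      moreover have "0 \<le> (B - 1) * (real (t - 1) * real n ^ w)" "0 \<le> real (Suc w) * real n ^ w"
        "0 \<le> \<epsilon> * real n ^ Suc w" "0 \<le> s" using B \<epsilon> unfolding s_def by (simp_all del: of_nat_sum)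
      \<comment> \<open>The chain is (B - 1) b' + s + b <= c + s + b <= a <= s + B b + \<epsilon>
        n^(w+1), and its two ends differ by at most K n^w + \<epsilon> n^(w+1). The (k-1)-sets in
        \<open>b\<close> supply the r = 0 term that turns B - 1 into B.\<close>
      ultimately have "\<bar>a - (c + (s + b))\<bar> \<le> K * real n ^ w + \<epsilon> * real n ^ Suc w"
        "\<bar>a - B * b\<bar> \<le> K * real n ^ w + \<epsilon> * real n ^ Suc w" using up by linarith+
      then show "\<bar>real (ex_complex n F) - (real (ex_clique k n (layer k F)) + real (\<Sum>r<k. n choose r))\<bar>
        \<le> K * real n ^ w + \<epsilon> * real n ^ Suc w \<and>
        \<bar>real (ex_complex n F) - B * real (n choose Suc w)\<bar> \<le> K * real n ^ w + \<epsilon> * real n ^ Suc w"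
        unfolding sum_k a_def[symmetric] b_def[symmetric] c_def[symmetric] by blast
    qed
  qed
  have "(\<lambda>n. real (ex_complex n F) - (real (ex_clique k n (layer k F)) + real (\<Sum>r<k. n choose r)))
      \<in> o(\<lambda>n. real n ^ Suc w)"
    by (rule smallo_powerI[of _ K]) (use bounds in meson)
  then have "asymptotically_trivial k F"
    using assms(3,4) unfolding asymptotically_trivial_def w(2) unfolding w(1) by simp
  moreover have "(\<lambda>n. real (ex_complex n F) - B * real (n choose Suc w)) \<in> o(\<lambda>n. real n ^ Suc w)"
    by (rule smallo_powerI[of _ K]) (use bounds in meson)
  moreover have "(\<Sum>r=0..t-1. real ((t - 1) choose r) * real (n choose (k - 1))) = B * real (n choose Suc w)" for n
  proof -
    have "(\<Sum>r=0..t-1. real ((t - 1) choose r)) = real (\<Sum>r\<le>t - 1. (t - 1) choose r)"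
      by (simp add: atMost_atLeast0)
    also have "\<dots> = B" unfolding choose_row_sum B_def by simp
    finally show ?thesis unfolding w(1) sum_distrib_right[symmetric] by simp
  qed
  ultimately show ?thesis unfolding w(1) by simp
qed

end
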